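(* Consider the block-issuance model described in the context, with $k\ge2$. For every $r>0$ there exists a constant $c_r<\infty$ such that \[ \sup_{n\ge0}\mathbb E\bigl[(X_n^{(o)})^r\bigr]\le c_r . \] The same holds for $X_n^{(i)}$, $i\in\mathcal N$, with constants that can be chosen uniformly over $i$.
   Context: **Model.** Let $\mathcal N=\{1,\dots,N\}$ be a finite set of nodes, $k\ge2$ an integer, $\lambda>0$ and $0\le\Delta<\infty$. Blocks are issued at times $0<t_1<t_2<\cdots$ forming a homogeneous Poisson process on $\mathbb R_+$ with rate $\lambda$; put $t_0:=0$. Block $n\ge1$, issued at $t_n$, carries a mark $\kappa_n=(\mathrm{blockID}_n,\mathrm{Ref}_n,\mathrm{nodeID}_n,\mathrm{delay}_n)$, where: - $\mathrm{blockID}_n$ are i.i.d. $\mathrm{Unif}[0,1]$, independent of the Poisson process (hence a.s. distinct); blocks are identified with their identifiers; - the issuers $\mathrm{nodeID}_n$ are i.i.d. $\mathcal N$-valued, independent of everything else; - $\mathrm{delay}_n=(\mathrm{delay}_n(j))_{j\in\mathcal N}$, where $\mathrm{delay}_n(j)\ge0$ is the time after $t_n$ until node $j$ receives block $n$. Delays are i.i.d. across blocks: if the issuer is $i$, the vector is drawn from a law depending only on $i$, with $j$-th coordinate distributed as $\Delta_i(j)$, and $\mathrm{delay}_n(i)=0$ for the issuer $i$. Conditional on $(t_m,\mathrm{blockID}_m,\mathrm{nodeID}_m)_{m\le n}$, $\mathrm{delay}_n$ is independent of the past. Partial synchrony: $\mathbb P(\Delta_i(j)\le\Delta)=1$ for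 all $i,j\in\mathcal N$; - $\mathrm{Ref}_n$ is the list of earlier blocks referenced by block $n$, defined below. There is a genesis block $\star$, visible to all nodes from time $0$. Messages with arrival time at most $t_n$ are processed before block $n$ is issued. For $i\in\mathcal N$, the pre-issuance local tip pool is \[\mathrm{pool}_n^-(i)=\Bigl(\{\star\}\cup\{\mathrm{blockID}_m: m<n,\ t_m+\mathrm{delay}_m(i)\le t_n\}\Bigr)\setminus\bigcup_{m<n:\,t_m+\mathrm{delay}_m(i)\le t_n}\{\text{entries of }\mathrm{Ref}_m\}.\] $\mathrm{Ref}_n$ consists of $\min\{k,|\mathrm{pool}_n^-(\mathrm{nodeID}_n)|\}$ distinct elements sampled uniformly without replacement from $\mathrm{pool}_n^-(\mathrm{nodeID}_n)$. The post-issuance local tip pool $\mathrm{pool}_n(i)$ is defined by the same formula with $m<n$ replaced by $m\le n$. The observer tip pool is $\mathrm{pool}_n^{(o)}=\bigl(\{\star\}\cup\{\mathrm{blockID}_1,\dots,\mathrm{blockID}_n\}\bigr)\setminus\bigcup_{m=1}^n\{\text{entries of }\mathrm{Ref}_m\}$. At $n=0$ all pools equal $\{\star\}$. Put $X_n^{(o)}=|\mathrm{pool}_n^{(o)}|$ and $X_n^{(i)}=|\mathrm{pool}_n(i)|$. *)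

theory Defs
  imports "HOL-Probability.Probability"
begin

section \<open>Blocks and reference lists\<close>

datatype ident = Genesis | Ident real

definition ident_space :: "ident measure" where
  "ident_space = sigma UNIV (insert {Genesis} ((\<lambda>A. Ident ` A) ` sets borel))"

text \<open>Reference lists carry the sigma-algebra generated by the finite measurable rectangles
  (the discrete one would be too large, since identifiers are continuously distributed).\<close>

definition refs_space :: "ident list measure" where
  "refs_space = sigma UNIV (listset ` lists (sets ident_space))"

text \<open>Ordered samples without replacement of size \<open>min k |S|\<close>.\<close>

definition samples :: "nat \<Rightarrow> 'a set \<Rightarrow> 'a list set" where
  "samples k S = {xs. distinct xs \<and> set xs \<subseteq> S \<and> length xs = min k (card S)}"


section \<open>The process and its tip pools\<close>

text \<open>The finite type \<open>'v\<close> is the set of nodes. Blocks are numbered from 1; index 0 is used only for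
  the convention that time 0 is the origin. \<open>delay P n \<omega> j\<close> is the time after issuance
  until node \<open>j\<close> receives block \<open>n\<close>.\<close>

record ('w, 'v) block_process =
  time :: "nat \<Rightarrow> 'w \<Rightarrow> real"
  blockID :: "nat \<Rightarrow> 'w \<Rightarrow> real"
  nodeID :: "nat \<Rightarrow> 'w \<Rightarrow> 'v"
  delay :: "nat \<Rightarrow> 'w \<Rightarrow> 'v \<Rightarrow> real"
  refs :: "nat \<Rightarrow> 'w \<Rightarrow> ident list"

definition tips :: "('w, 'v) block_process \<Rightarrow> 'w \<Rightarrow> nat set \<Rightarrow> ident set" where
  "tips P \<omega> S =
     ({Genesis} \<union> (\<lambda>m. Ident (blockID P m \<omega>)) ` S) - (\<Union>m\<in>S. set (refs P m \<omega>))"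

definition pool_pre :: "('w, 'v) block_process \<Rightarrow> nat \<Rightarrow> 'v \<Rightarrow> 'w \<Rightarrow> ident set" where
  "pool_pre P n i \<omega> =
     tips P \<omega> {m \<in> {1..<n}. time P m \<omega> + delay P m \<omega> i \<le> time P n \<omega>}"

definition pool :: "('w, 'v) block_process \<Rightarrow> nat \<Rightarrow> 'v \<Rightarrow> 'w \<Rightarrow> ident set" where
  "pool P n i \<omega> =
     tips P \<omega> {m \<in> {1..n}. time P m \<omega> + delay P m \<omega> i \<le> time P n \<omega>}"

definition pool_obs :: "('w, 'v) block_process \<Rightarrow> nat \<Rightarrow> 'w \<Rightarrow> ident set" where
  "pool_obs P n \<omega> = tips P \<omega> {1..n}"


section \<open>Probabilistic assumptions\<close>

definition iid :: "'w measure \<Rightarrow> 'a measure \<Rightarrow> (nat \<Rightarrow> 'w \<Rightarrow> 'a) \<Rightarrow> bool" where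
  "iid M L X \<longleftrightarrow>
     prob_space.indep_vars M (\<lambda>_. L) X {1..} \<and> (\<forall>n\<ge>1. distr M L (X n) = L)"

definition gap :: "(nat \<Rightarrow> 'w \<Rightarrow> real) \<Rightarrow> nat \<Rightarrow> 'w \<Rightarrow> real" where
  "gap t n \<omega> = t n \<omega> - t (n - 1) \<omega>"

text \<open>Arrival times of a homogeneous Poisson process, i.e. partial sums of i.i.d. exponential
  gaps. In particular they are almost surely positive and strictly increasing.\<close>

definition poisson_arrivals :: "'w measure \<Rightarrow> real \<Rightarrow> (nat \<Rightarrow> 'w \<Rightarrow> real) \<Rightarrow> bool" where
  "poisson_arrivals M rate t \<longleftrightarrow>
     (\<forall>\<omega>\<in>space M. t 0 \<omega> = 0) \<and>
     iid M (density lborel (exponential_density rate)) (gap t)"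

definition events_of :: "'w measure \<Rightarrow> ('w \<Rightarrow> 'a) \<Rightarrow> 'a measure \<Rightarrow> 'w set set" where
  "events_of M X S = {X -` A \<inter> space M | A. A \<in> sets S}"

abbreviation delay_space :: "('v \<Rightarrow> real) measure" where
  "delay_space \<equiv> PiM UNIV (\<lambda>_. borel)"

text \<open>The sigma-algebra generated by the times, identifiers and issuers of blocks \<open>1..a\<close>,
  the delays of blocks \<open>1..b\<close> and the references of blocks \<open>1..c\<close>.\<close>

definition hist :: "'w measure \<Rightarrow> ('w, 'v) block_process \<Rightarrow> nat \<Rightarrow> nat \<Rightarrow> nat \<Rightarrow> 'w measure" where
  "hist M P a b c = sigma (space M)
     ((\<Union>m\<in>{1..a}. events_of M (time P m) borel \<union> events_of M (blockID P m) borel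
          \<union> events_of M (nodeID P m) (count_space UNIV))
      \<union> (\<Union>m\<in>{1..b}. events_of M (delay P m) delay_space)
      \<union> (\<Union>m\<in>{1..c}. events_of M (refs P m) refs_space))"

text \<open>Conditionally on \<open>F\<close>, the random element \<open>X\<close> of \<open>S\<close> has the (random) law \<open>K\<close>.\<close>

definition cond_law ::
  "'w measure \<Rightarrow> 'w measure \<Rightarrow> ('w \<Rightarrow> 'a) \<Rightarrow> 'a measure \<Rightarrow> ('w \<Rightarrow> 'a measure) \<Rightarrow> bool" where
  "cond_law M F X S K \<longleftrightarrow> X \<in> measurable M S \<and>
     (\<forall>B\<in>sets S. AE \<omega> in M. real_cond_exp M F (\<lambda>\<omega>. indicator B (X \<omega>)) \<omega> = measure (K \<omega>) B)"

text \<open>\<open>nu\<close> is the common law of the issuers and \<open>D i\<close> the joint law of the delay vector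
  \<open>(\<Delta>_i(j))_j\<close> of a block issued by \<open>i\<close>. The assumption \<open>fresh\<close> says that, at each step, the whole
  past, the next gap, the next identifier and the next issuer are mutually independent;
  inductively, the three driving sequences are therefore independent of each other, and nothing
  in the past anticipates their future. At step \<open>n\<close> the delays are drawn next, given
  the issuer, and the references are then sampled independently of them.\<close>

locale block_model = prob_space M
  for M :: "'w measure" +
  fixes P :: "('w, 'v::finite) block_process"
    and nu :: "'v pmf"
    and D :: "'v \<Rightarrow> ('v \<Rightarrow> real) measure"
    and k :: nat
    and rate Delta :: real
  assumes k_ge_2: "k \<ge> 2"
    and rate_pos: "rate > 0"
    and Delta_nonneg: "Delta \<ge> 0"
    and D_prob: "\<And>i. prob_space (D i)"
    and D_sets: "\<And>i. sets (D i) = sets delay_space"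
    and D_issuer: "\<And>i. AE d in D i. d i = 0"
    and D_nonneg: "\<And>i j. AE d in D i. 0 \<le> d j"
    and partial_synchrony: "\<And>i j. AE d in D i. d j \<le> Delta"
    and poisson: "poisson_arrivals M rate (time P)"
    and blockID_iid: "iid M (uniform_measure lborel {0..1}) (blockID P)"
    and nodeID_iid: "iid M (measure_pmf nu) (nodeID P)"
    and fresh: "\<And>n. n \<ge> 1 \<Longrightarrow> indep_sets
        ((!) [sets (hist M P (n - 1) (n - 1) (n - 1)),
              events_of M (gap (time P) n) borel,
              events_of M (blockID P n) borel,
              events_of M (nodeID P n) (count_space UNIV)]) {..<4}"
    and delay_law: "\<And>n. n \<ge> 1 \<Longrightarrow>
        cond_law M (hist M P n (n - 1) (n - 1)) (delay P n) delay_space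
          (\<lambda>\<omega>. D (nodeID P n \<omega>))"
    and refs_law: "\<And>n. n \<ge> 1 \<Longrightarrow>
        cond_law M (hist M P n n (n - 1)) (refs P n) refs_space
          (\<lambda>\<omega>. measure_pmf (pmf_of_set (samples k (pool_pre P n (nodeID P n \<omega>) \<omega>))))"

end

theory Submission
  imports Defs "HOL-Real_Asymp.Real_Asymp"
begin

text \<open>
  Write \<open>X n\<close> for the size of the observer tip pool after block \<open>n\<close> and \<open>L n\<close> for the number of
  blocks before \<open>n\<close> that were issued less than \<open>Delta\<close> before block \<open>n\<close>. Partial synchrony says that
  the issuer of block \<open>n\<close> already knows every other earlier block, so its local tip pool differs
  from the observer pool by at most \<open>L n\<close> missing tips and at most \<open>k * L n\<close> obsolete ones, namely
  entries of references it has not received. If \<open>X (n - 1)\<close> is large compared with \<open>L n\<close>, a uniform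
  sample of at least two local tips therefore consists of observer tips only, with probability at least
  \<open>7/8\<close>, and then the pool shrinks by at least one. Otherwise it grows by at most one. Hence the
  Lyapunov function \<open>2 ^ X\<close> satisfies the conditional bound
  \<open>E (2 ^ X n) \<le> (1/2 + 2 * (1/8)) * 2 ^ X (n - 1)\<close> on this event.

  In general \<open>L n\<close> is not bounded in terms of \<open>X (n - 1)\<close>, and the two are dependent.
  The point that makes the argument short is that this dependence is harmless: when \<open>X (n - 1)\<close> is
  smaller than \<open>(8 * k^2 + 1) * L n\<close>, then \<open>2 ^ X n\<close> is at most twice \<open>z ^ L n\<close> with
  \<open>z = 2 ^ (8 * k^2 + 1)\<close>. A sum of \<open>l\<close> exponential gaps is below \<open>Delta\<close> with a probability that
  decays faster than any geometric sequence in \<open>l\<close>, so \<open>E (z ^ L n)\<close> is bounded uniformly in \<open>n\<close> for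
  every \<open>z\<close> (\<open>exp_moment_recent\<close>). Together this gives
  \<open>E (2 ^ X n) \<le> const + 3/4 * E (2 ^ X (n - 1))\<close> (\<open>pool_obs_drift\<close>), so \<open>E (2 ^ X n)\<close> is bounded
  (\<open>exp_moment_pool_obs\<close>). A local pool exceeds the observer pool by at most \<open>k * (L n + 1)\<close>
  elements, which again has all exponential moments; powers are dominated by exponentials
  (\<open>moment_bound\<close>).

  The measure-theoretic work lies in the sampling step. The law of the references is given
  separately for each fixed set of lists, whereas the set of lists contained in the observer pool is
  random. A Dynkin argument (\<open>cond_law_nn_cond_exp_section\<close>) extends the conditional law to sets that
  vary measurably with the past.
\<close>


section \<open>Integrating over a conditional law\<close>

lemma cond_law_nn_cond_exp_indicator:
  assumes fms: "finite_measure_subalgebra M F"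
    and law: "cond_law M F X S K" and B: "B \<in> sets S"
    and K: "\<And>\<omega>. prob_space (K \<omega>)"
  shows "AE \<omega> in M. nn_cond_exp M F (\<lambda>\<omega>. indicator B (X \<omega>)) \<omega> = emeasure (K \<omega>) B"
proof -
  interpret finite_measure_subalgebra M F by fact
  have X[measurable]: "X \<in> measurable M S"
    using law by (simp add: cond_law_def)
  note B[measurable]
  let ?f = "\<lambda>\<omega>. indicator B (X \<omega>) :: ennreal"
  have "AE \<omega> in M. nn_cond_exp M F ?f \<omega> \<le> nn_cond_exp M F (\<lambda>_. 1) \<omega>"
    by (rule nn_cond_exp_mono) (auto simp: indicator_def)
  moreover have "AE \<omega> in M. 1 = nn_cond_exp M F (\<lambda>_. 1) \<omega>"
    by (rule nn_cond_exp_F_meas) auto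
  moreover have "AE \<omega> in M. 0 = nn_cond_exp M F (\<lambda>_. 0) \<omega>"
    by (rule nn_cond_exp_F_meas) auto
  moreover have "AE \<omega> in M. real_cond_exp M F (\<lambda>\<omega>. indicator B (X \<omega>)) \<omega> = measure (K \<omega>) B"
    using law B by (simp add: cond_law_def)
  ultimately show ?thesis
  proof eventually_elim
    case (elim \<omega>)
    interpret K: prob_space "K \<omega>" by (rule K)
    have 1: "(\<lambda>\<omega>. ennreal (indicator B (X \<omega>))) = ?f"
      by (auto simp: fun_eq_iff indicator_def)
    have 2: "(\<lambda>\<omega>. ennreal (- indicator B (X \<omega>))) = (\<lambda>_. 0)"
      by (auto simp: fun_eq_iff ennreal_neg)
    have "enn2real (nn_cond_exp M F ?f \<omega>) = measure (K \<omega>) B"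
      using elim(3)[symmetric] elim(4) by (simp add: real_cond_exp_def 1 2)
    moreover have "nn_cond_exp M F ?f \<omega> < \<top>"
      using elim(1,2) by (metis ennreal_one_less_top order.strict_trans1)
    ultimately show ?case
      by (simp add: K.emeasure_eq_measure) (metis ennreal_enn2real)
  qed
qed

lemma cond_law_AE_mem:
  assumes prob: "prob_space M" and fms: "finite_measure_subalgebra M F"
    and law: "cond_law M F X S K" and B: "B \<in> sets S"
    and K: "\<And>\<omega>. prob_space (K \<omega>)" and full: "\<And>\<omega>. emeasure (K \<omega>) B = 1"
  shows "AE \<omega> in M. X \<omega> \<in> B"
proof -
  interpret prob_space M by fact
  interpret finite_measure_subalgebra M F by fact
  have X[measurable]: "X \<in> measurable M S"
    using law by (simp add: cond_law_def)
  note B[measurable]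
  have "(\<integral>\<^sup>+\<omega>. indicator B (X \<omega>) \<partial>M) = (\<integral>\<^sup>+\<omega>. 1 * nn_cond_exp M F (\<lambda>\<omega>. indicator B (X \<omega>)) \<omega> \<partial>M)"
    by (subst nn_cond_exp_intg) auto
  also have "\<dots> = (\<integral>\<^sup>+\<omega>. 1 \<partial>M)"
    by (intro nn_integral_cong_AE)
      (use cond_law_nn_cond_exp_indicator[OF fms law B K] full in auto)
  also have "\<dots> = 1"
    by (simp add: emeasure_space_1)
  also have "(\<integral>\<^sup>+\<omega>. indicator B (X \<omega>) \<partial>M) = (\<integral>\<^sup>+\<omega>. indicator {\<omega>\<in>space M. X \<omega> \<in> B} \<omega> \<partial>M)"
    by (intro nn_integral_cong) (auto simp: indicator_def)
  also have "\<dots> = emeasure M {\<omega>\<in>space M. X \<omega> \<in> B}"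
    by (rule nn_integral_indicator) measurable
  finally show ?thesis
    by (subst AE_iff_emeasure_eq_1) auto
qed

text \<open>The set may depend measurably on \<open>\<omega>\<close> through \<open>F\<close>: the identity holds for rectangles by
  pulling out the \<open>F\<close>-measurable factor, and passes to complements and disjoint unions. The kernel
  is compared with \<open>nn_cond_exp\<close> almost everywhere, which supplies an \<open>F\<close>-measurable version of
  \<open>\<omega> \<mapsto> emeasure (K \<omega>) (Pair \<omega> -` C)\<close>.\<close>
lemma cond_law_nn_cond_exp_section:
  assumes fms: "finite_measure_subalgebra M F"
    and law: "cond_law M F X S K" and C: "C \<in> sets (F \<Otimes>\<^sub>M S)"
    and K: "\<And>\<omega>. prob_space (K \<omega>)" and sets_K: "\<And>\<omega>. sets S \<subseteq> sets (K \<omega>)"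
    and space_K: "\<And>\<omega>. space (K \<omega>) = space S"
  shows "AE \<omega> in M. nn_cond_exp M F (\<lambda>\<omega>. indicator C (\<omega>, X \<omega>)) \<omega> = emeasure (K \<omega>) (Pair \<omega> -` C)"
proof -
  interpret finite_measure_subalgebra M F by fact
  have [measurable]: "X \<in> measurable M S"
    using law by (simp add: cond_law_def)
  have spF[simp]: "space F = space M"
    using subalg by (simp add: subalgebra_def)
  have [measurable]: "(\<lambda>\<omega>. \<omega>) \<in> measurable M F"
    using subalg by (auto simp: subalgebra_def measurable_def)
  have Xp[measurable]: "(\<lambda>\<omega>. (\<omega>, X \<omega>)) \<in> measurable M (F \<Otimes>\<^sub>M S)" by measurable
  have C': "C \<in> sigma_sets (space F \<times> space S) {a \<times> b | a b. a \<in> sets F \<and> b \<in> sets S}"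
    using C by (simp add: sets_pair_measure)
  show ?thesis
    using Int_stable_pair_measure_generator pair_measure_closed C'
  proof (induct rule: sigma_sets_induct_disjoint)
    case (basic C)
    then obtain A B where C: "C = A \<times> B" and [measurable]: "A \<in> sets F" and B[measurable]: "B \<in> sets S"
      by auto
    have eq: "(\<lambda>\<omega>. indicator C (\<omega>, X \<omega>)) = (\<lambda>\<omega>. indicator A \<omega> * indicator B (X \<omega>) :: ennreal)"
      by (auto simp: C fun_eq_iff indicator_def)
    have "AE \<omega> in M. indicator A \<omega> * nn_cond_exp M F (\<lambda>\<omega>. indicator B (X \<omega>)) \<omega>
        = nn_cond_exp M F (\<lambda>\<omega>. indicator C (\<omega>, X \<omega>)) \<omega>"
      unfolding eq by (rule nn_cond_exp_prod) auto
    moreover note cond_law_nn_cond_exp_indicator[OF fms law B K]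
    ultimately show ?case
    proof eventually_elim
      case (elim \<omega>)
      then show ?case
        by (cases "\<omega> \<in> A") (auto simp: C)
    qed
  next
    case empty
    have "AE \<omega> in M. 0 = nn_cond_exp M F (\<lambda>_. 0) \<omega>"
      by (rule nn_cond_exp_F_meas) auto
    then show ?case by simp
  next
    case (compl C)
    have C[measurable]: "C \<in> sets (F \<Otimes>\<^sub>M S)" using compl by (simp add: sets_pair_measure)
    let ?C = "space F \<times> space S - C"
    have C2[measurable]: "?C \<in> sets (F \<Otimes>\<^sub>M S)" by measurable
    have "AE \<omega> in M. nn_cond_exp M F (\<lambda>\<omega>. indicator ?C (\<omega>, X \<omega>)) \<omega>
        + nn_cond_exp M F (\<lambda>\<omega>. indicator C (\<omega>, X \<omega>)) \<omega>
        = nn_cond_exp M F (\<lambda>\<omega>. indicator ?C (\<omega>, X \<omega>) + indicator C (\<omega>, X \<omega>)) \<omega>"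
      by (rule nn_cond_exp_sum) auto
    moreover have "AE \<omega> in M. nn_cond_exp M F (\<lambda>\<omega>. indicator ?C (\<omega>, X \<omega>) + indicator C (\<omega>, X \<omega>)) \<omega>
        = nn_cond_exp M F (\<lambda>_. 1) \<omega>"
    proof (rule nn_cond_exp_cong)
      have "\<omega> \<in> space M \<Longrightarrow> X \<omega> \<in> space S" for \<omega>
        using measurable_space[of X M S] by simp
      then show "AE \<omega> in M. indicator ?C (\<omega>, X \<omega>) + indicator C (\<omega>, X \<omega>) = (1::ennreal)"
        by (auto simp: indicator_def)
    qed auto
    moreover have "AE \<omega> in M. 1 = nn_cond_exp M F (\<lambda>_. 1) \<omega>"
      by (rule nn_cond_exp_F_meas) auto
    moreover note compl(2) AE_space
    ultimately show ?case
    proof eventually_elim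
      case (elim \<omega>)
      interpret K: prob_space "K \<omega>" by (rule K)
      have s: "Pair \<omega> -` C \<in> sets (K \<omega>)"
        using sets_Pair1[OF C] sets_K by blast
      have "Pair \<omega> -` ?C = space (K \<omega>) - Pair \<omega> -` C"
        using elim(5) by (auto simp: space_K)
      then have "emeasure (K \<omega>) (Pair \<omega> -` ?C) = 1 - emeasure (K \<omega>) (Pair \<omega> -` C)"
        using s by (simp add: emeasure_compl K.emeasure_space_1)
      moreover have "nn_cond_exp M F (\<lambda>\<omega>. indicator ?C (\<omega>, X \<omega>)) \<omega> = 1 - emeasure (K \<omega>) (Pair \<omega> -` C)"
        using elim(1-4) by (metis ennreal_add_diff_cancel_right K.emeasure_finite)
      ultimately show ?case by simp
    qed
  next
    case (union C)
    have C[measurable]: "C i \<in> sets (F \<Otimes>\<^sub>M S)" for i using union by (auto simp: sets_pair_measure)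
    have ind: "indicator (\<Union>i. C i) x = (\<Sum>i. indicator (C i) x :: ennreal)" for x
      using suminf_indicator[OF union(1), of x] by simp
    have "AE \<omega> in M. (\<Sum>i. nn_cond_exp M F (\<lambda>\<omega>. indicator (C i) (\<omega>, X \<omega>)) \<omega>)
        = nn_cond_exp M F (\<lambda>\<omega>. indicator (\<Union>i. C i) (\<omega>, X \<omega>)) \<omega>"
    proof (rule nn_cond_exp_charact)
      fix A assume A[measurable]: "A \<in> sets F"
      then have [measurable]: "A \<in> sets M" using subalg by (auto simp: subalgebra_def)
      have "(\<integral>\<^sup>+\<omega>\<in>A. indicator (\<Union>i. C i) (\<omega>, X \<omega>) \<partial>M)
          = (\<integral>\<^sup>+\<omega>. (\<Sum>i. indicator A \<omega> * indicator (C i) (\<omega>, X \<omega>)) \<partial>M)"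
        unfolding ind by (simp add: mult.commute)
      also have "\<dots> = (\<Sum>i. \<integral>\<^sup>+\<omega>. indicator A \<omega> * indicator (C i) (\<omega>, X \<omega>) \<partial>M)"
        by (rule nn_integral_suminf) measurable
      also have "\<dots> = (\<Sum>i. \<integral>\<^sup>+\<omega>. indicator A \<omega> * nn_cond_exp M F (\<lambda>\<omega>. indicator (C i) (\<omega>, X \<omega>)) \<omega> \<partial>M)"
        by (subst nn_cond_exp_intg) auto
      also have "\<dots> = (\<integral>\<^sup>+\<omega>. (\<Sum>i. indicator A \<omega> * nn_cond_exp M F (\<lambda>\<omega>. indicator (C i) (\<omega>, X \<omega>)) \<omega>) \<partial>M)"
        by (rule nn_integral_suminf[symmetric]) measurable
      finally show "(\<integral>\<^sup>+\<omega>\<in>A. indicator (\<Union>i. C i) (\<omega>, X \<omega>) \<partial>M)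
          = (\<integral>\<^sup>+\<omega>\<in>A. (\<Sum>i. nn_cond_exp M F (\<lambda>\<omega>. indicator (C i) (\<omega>, X \<omega>)) \<omega>) \<partial>M)"
        by (simp add: mult.commute)
    next
      show "(\<lambda>\<omega>. indicator (\<Union>i. C i) (\<omega>, X \<omega>) :: ennreal) \<in> borel_measurable M"
        by (rule measurable_compose[OF Xp]) simp
      show "(\<lambda>\<omega>. \<Sum>i. nn_cond_exp M F (\<lambda>\<omega>. indicator (C i) (\<omega>, X \<omega>)) \<omega>) \<in> borel_measurable F"
        by (intro borel_measurable_suminf_order borel_measurable_nn_cond_exp)
    qed
    moreover have "AE \<omega> in M. \<forall>i. nn_cond_exp M F (\<lambda>\<omega>. indicator (C i) (\<omega>, X \<omega>)) \<omega> = emeasure (K \<omega>) (Pair \<omega> -` C i)"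
      using union(3) by (simp add: AE_all_countable)
    ultimately show ?case
    proof eventually_elim
      case (elim \<omega>)
      have "(\<Sum>i. emeasure (K \<omega>) (Pair \<omega> -` C i)) = emeasure (K \<omega>) (\<Union>i. Pair \<omega> -` C i)"
        using union(1) sets_Pair1[OF C] sets_K
        by (intro suminf_emeasure) (force simp: disjoint_family_on_def)+
      then show ?case using elim by (simp add: vimage_UN)
    qed
  qed
qed

text \<open>The form in which conditional laws are used below: a weight from the past, and a bound on the
  conditional probability of a random set where this weight is nonzero.\<close>
lemma cond_law_nn_integral_le:
  fixes h :: "'w \<Rightarrow> ennreal"
  assumes fms: "finite_measure_subalgebra M F"
    and law: "cond_law M F X S K" and C[measurable]: "C \<in> sets (F \<Otimes>\<^sub>M S)"
    and K: "\<And>\<omega>. prob_space (K \<omega>)" and sets_K: "\<And>\<omega>. sets S \<subseteq> sets (K \<omega>)"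
    and space_K: "\<And>\<omega>. space (K \<omega>) = space S"
    and h[measurable]: "h \<in> borel_measurable F"
    and bound: "AE \<omega> in M. h \<omega> \<noteq> 0 \<longrightarrow> emeasure (K \<omega>) (Pair \<omega> -` C) \<le> c"
  shows "(\<integral>\<^sup>+\<omega>. h \<omega> * indicator C (\<omega>, X \<omega>) \<partial>M) \<le> c * (\<integral>\<^sup>+\<omega>. h \<omega> \<partial>M)"
proof -
  interpret finite_measure_subalgebra M F by fact
  have [measurable]: "X \<in> measurable M S"
    using law by (simp add: cond_law_def)
  have [measurable]: "(\<lambda>\<omega>. \<omega>) \<in> measurable M F"
    using subalg by (auto simp: subalgebra_def measurable_def)
  have "(\<integral>\<^sup>+\<omega>. h \<omega> * indicator C (\<omega>, X \<omega>) \<partial>M)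
      = (\<integral>\<^sup>+\<omega>. h \<omega> * nn_cond_exp M F (\<lambda>\<omega>. indicator C (\<omega>, X \<omega>)) \<omega> \<partial>M)"
    by (rule nn_cond_exp_intg[symmetric]) auto
  also have "\<dots> \<le> (\<integral>\<^sup>+\<omega>. c * h \<omega> \<partial>M)"
  proof (rule nn_integral_mono_AE)
    show "AE \<omega> in M. h \<omega> * nn_cond_exp M F (\<lambda>\<omega>. indicator C (\<omega>, X \<omega>)) \<omega> \<le> c * h \<omega>"
      using bound cond_law_nn_cond_exp_section[OF fms law C K sets_K space_K]
    proof eventually_elim
      case (elim \<omega>)
      then show ?case
        by (cases "h \<omega> = 0") (auto simp: mult.commute[of c] intro: mult_left_mono)
    qed
  qed
  also have "\<dots> = c * (\<integral>\<^sup>+\<omega>. h \<omega> \<partial>M)"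
    using measurable_from_subalg[OF subalg h] by (rule nn_integral_cmult)
  finally show ?thesis .
qed


section \<open>Uniform samples without replacement\<close>

lemma finite_samples: "finite S \<Longrightarrow> finite (samples k S)"
  by (rule finite_subset[OF _ finite_lists_length_eq[of S "min k (card S)"]]) (auto simp: samples_def)

lemma samples_nonempty:
  assumes "finite S" shows "samples k S \<noteq> {}"
proof -
  obtain ys where "set ys = S" "distinct ys"
    using finite_distinct_list[OF assms] by blast
  then have "take k ys \<in> samples k S"
    using distinct_card[of ys] by (auto simp: samples_def min.commute dest: in_set_takeD)
  then show ?thesis by auto
qed

text \<open>Swapping \<open>a\<close> and \<open>b\<close> maps samples to samples.\<close>
lemma card_samples_containing_eq:
  assumes S: "finite S" "a \<in> S" "b \<in> S"
  shows "card {xs \<in> samples k S. a \<in> set xs} = card {xs \<in> samples k S. b \<in> set xs}"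
proof -
  let ?t = "Transposition.transpose a b"
  have t: "?t ` S = S"
    using S(2,3) by simp
  have "bij_betw (map ?t) {xs \<in> samples k S. a \<in> set xs} {xs \<in> samples k S. b \<in> set xs}"
  proof (rule bij_betwI[where g="map ?t"])
    show "map ?t \<in> {xs \<in> samples k S. a \<in> set xs} \<rightarrow> {xs \<in> samples k S. b \<in> set xs}"
      using t by (force simp: samples_def distinct_map intro: inj_on_subset[OF inj_transpose])
    show "map ?t \<in> {xs \<in> samples k S. b \<in> set xs} \<rightarrow> {xs \<in> samples k S. a \<in> set xs}"
      using t by (force simp: samples_def distinct_map intro: inj_on_subset[OF inj_transpose])
  qed (simp_all add: o_def)
  then show ?thesis by (rule bij_betw_same_card)
qed

text \<open>Count the pairs of a sample and one of its entries in two ways; by symmetry all elements of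
  \<open>S\<close> contribute equally.\<close>
lemma card_samples_containing:
  assumes S: "finite S" and a: "a \<in> S"
  shows "card S * card {xs \<in> samples k S. a \<in> set xs} = min k (card S) * card (samples k S)"
proof -
  have "card S * card {xs \<in> samples k S. a \<in> set xs}
      = (\<Sum>b\<in>S. card {xs \<in> samples k S. b \<in> set xs})"
    using card_samples_containing_eq[OF S(1) _ a] by simp
  also have "\<dots> = (\<Sum>b\<in>S. \<Sum>xs\<in>samples k S. of_bool (b \<in> set xs))"
    using finite_samples[OF S] by (simp add: Int_def)
  also have "\<dots> = (\<Sum>xs\<in>samples k S. \<Sum>b\<in>S. of_bool (b \<in> set xs))"
    by (rule sum.swap)
  also have "\<dots> = (\<Sum>xs\<in>samples k S. min k (card S))"
  proof (rule sum.cong[OF refl])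
    fix xs assume xs: "xs \<in> samples k S"
    then have "S \<inter> {b. b \<in> set xs} = set xs" by (auto simp: samples_def)
    then show "(\<Sum>b\<in>S. of_bool (b \<in> set xs)) = min k (card S)"
      using S xs by (simp add: samples_def distinct_card)
  qed
  finally show ?thesis by (simp add: mult.commute)
qed

lemma card_samples_meeting_le:
  assumes S: "finite S" and W: "W \<subseteq> S"
  shows "card S * card {xs \<in> samples k S. set xs \<inter> W \<noteq> {}} \<le> k * card W * card (samples k S)"
proof -
  have fW: "finite W" using S W finite_subset by blast
  have "{xs \<in> samples k S. set xs \<inter> W \<noteq> {}} = (\<Union>a\<in>W. {xs \<in> samples k S. a \<in> set xs})"
    by auto
  then have "card S * card {xs \<in> samples k S. set xs \<inter> W \<noteq> {}}
      \<le> card S * (\<Sum>a\<in>W. card {xs \<in> samples k S. a \<in> set xs})"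
    by (simp only:) (intro mult_left_mono card_UN_le[OF fW] le0)
  also have "\<dots> = (\<Sum>a\<in>W. min k (card S) * card (samples k S))"
    unfolding sum_distrib_left
    using W by (intro sum.cong refl card_samples_containing[OF S]) auto
  also have "\<dots> \<le> k * card W * card (samples k S)"
    by (simp add: mult.assoc mult.left_commute)
  finally show ?thesis .
qed

text \<open>A sample from \<open>U\<close> fails to consist of at least two elements of \<open>Q\<close> only if it meets
  \<open>U - Q\<close>; the expected number of such entries is at most \<open>k * card (U - Q) / card U\<close>.\<close>
lemma clean_sample_prob:
  assumes U: "finite U" "2 \<le> card U" and k: "2 \<le> k" and W: "8 * k * card (U - Q) \<le> card U"
  shows "emeasure (measure_pmf (pmf_of_set (samples k U)))
      {xs. \<not> (distinct xs \<and> 2 \<le> length xs \<and> set xs \<subseteq> Q)} \<le> ennreal (1/8)"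
    (is "emeasure _ ?C \<le> _")
proof -
  let ?N = "card (samples k U)" and ?B = "{xs \<in> samples k U. set xs \<inter> (U - Q) \<noteq> {}}"
  have "samples k U \<inter> ?C \<subseteq> ?B"
    using U k by (auto simp: samples_def)
  then have "card (samples k U \<inter> ?C) \<le> card ?B"
    using finite_samples[OF U(1)] by (intro card_mono) auto
  moreover have "8 * card ?B \<le> ?N"
  proof -
    have "card U * (8 * card ?B) \<le> 8 * (k * card (U - Q) * ?N)"
      using card_samples_meeting_le[OF U(1), of "U - Q" k] by (simp add: Diff_subset)
    also have "\<dots> = (8 * k * card (U - Q)) * ?N" by simp
    also have "\<dots> \<le> card U * ?N" using W by (rule mult_le_mono1)
    finally show ?thesis using U(2) by simp
  qed
  moreover have "0 < ?N"
    using finite_samples[OF U(1)] samples_nonempty[OF U(1)] by (simp add: card_gt_0_iff)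
  ultimately have "real (card (samples k U \<inter> ?C)) / real ?N \<le> 1/8"
    by (simp add: field_simps flip: of_nat_mult of_nat_le_iff)
  then show ?thesis
    using emeasure_pmf_of_set[OF samples_nonempty[OF U(1)] finite_samples[OF U(1)], where A="?C"]
    by (simp add: ennreal_leI)
qed


section \<open>How tip sets change\<close>

lemma finite_tips: "finite S \<Longrightarrow> finite (tips P \<omega> S)"
  by (simp add: tips_def)

lemma card_UN_set_refs_le:
  assumes "finite A" "\<And>j. j \<in> A \<Longrightarrow> length (f j) \<le> k"
  shows "card (\<Union>j\<in>A. set (f j)) \<le> k * card A"
proof -
  have "card (\<Union>j\<in>A. set (f j)) \<le> (\<Sum>j\<in>A. card (set (f j)))"
    by (rule card_UN_le[OF assms(1)])
  also have "\<dots> \<le> (\<Sum>j\<in>A. k)"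
    using assms(2) by (intro sum_mono) (meson card_length order_trans)
  finally show ?thesis by (simp add: mult.commute)
qed

text \<open>Knowing the blocks \<open>S\<close> instead of \<open>T\<close>, one keeps as tips only those obsolete blocks that are
  referenced from \<open>T - S\<close>.\<close>
lemma card_tips_diff_le:
  assumes "S \<subseteq> T" "finite T" "\<And>j. j \<in> T \<Longrightarrow> length (refs P j \<omega>) \<le> k"
  shows "card (tips P \<omega> S - tips P \<omega> T) \<le> k * card (T - S)"
proof -
  have "tips P \<omega> S - tips P \<omega> T \<subseteq> (\<Union>j\<in>T - S. set (refs P j \<omega>))"
    using assms(1) by (auto simp: tips_def)
  then have "card (tips P \<omega> S - tips P \<omega> T) \<le> card (\<Union>j\<in>T - S. set (refs P j \<omega>))"
    using assms(2) by (intro card_mono) auto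
  also have "\<dots> \<le> k * card (T - S)"
    using assms by (intro card_UN_set_refs_le) auto
  finally show ?thesis .
qed

text \<open>In the other direction, ignorance of \<open>T - S\<close> can only add the obsolete blocks referenced there.\<close>
lemma card_tips_le_subset:
  assumes "S \<subseteq> T" "finite T" "\<And>j. j \<in> T \<Longrightarrow> length (refs P j \<omega>) \<le> k"
  shows "card (tips P \<omega> S) \<le> card (tips P \<omega> T) + k * card (T - S)"
proof -
  have fS: "finite S" using assms finite_subset by blast
  have "card (tips P \<omega> S) \<le> card (tips P \<omega> T \<union> (tips P \<omega> S - tips P \<omega> T))"
    using assms(2) fS by (intro card_mono) (auto intro: finite_tips)
  also have "\<dots> \<le> card (tips P \<omega> T) + card (tips P \<omega> S - tips P \<omega> T)"
    by (rule card_Un_le)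
  finally show ?thesis
    using card_tips_diff_le[where k=k, OF assms] by simp
qed

text \<open>Learning about the blocks in \<open>T - S\<close> creates no tips other than these blocks.\<close>
lemma card_tips_le_superset:
  assumes "S \<subseteq> T" "finite T"
  shows "card (tips P \<omega> T) \<le> card (tips P \<omega> S) + card (T - S)"
proof -
  have fS: "finite S" using assms finite_subset by blast
  have "tips P \<omega> T \<subseteq> tips P \<omega> S \<union> (\<lambda>m. Ident (blockID P m \<omega>)) ` (T - S)"
    using assms(1) by (auto simp: tips_def)
  then have "card (tips P \<omega> T) \<le> card (tips P \<omega> S \<union> (\<lambda>m. Ident (blockID P m \<omega>)) ` (T - S))"
    using assms(2) fS by (intro card_mono) (auto intro: finite_tips)
  also have "\<dots> \<le> card (tips P \<omega> S) + card ((\<lambda>m. Ident (blockID P m \<omega>)) ` (T - S))"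
    by (rule card_Un_le)
  also have "\<dots> \<le> card (tips P \<omega> S) + card (T - S)"
    using assms(2) by (simp add: card_image_le)
  finally show ?thesis .
qed

lemma finite_pool_obs: "finite (pool_obs P n \<omega>)"
  by (simp add: pool_obs_def finite_tips)

lemma card_pool_obs_0: "card (pool_obs P 0 \<omega>) = 1"
  by (simp add: pool_obs_def tips_def)

text \<open>The new block is the only possible new tip, and each observer tip that it references is lost.\<close>
lemma card_pool_obs_step:
  "card (pool_obs P (Suc n) \<omega>) + card (pool_obs P n \<omega> \<inter> set (refs P (Suc n) \<omega>))
    \<le> card (pool_obs P n \<omega>) + 1"
proof -
  let ?O = "pool_obs P n \<omega>" and ?R = "set (refs P (Suc n) \<omega>)"
  have "pool_obs P (Suc n) \<omega> \<subseteq> insert (Ident (blockID P (Suc n) \<omega>)) (?O - ?R)"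
    by (auto simp: pool_obs_def tips_def atLeastAtMostSuc_conv)
  then have "card (pool_obs P (Suc n) \<omega>) \<le> card (insert (Ident (blockID P (Suc n) \<omega>)) (?O - ?R))"
    by (intro card_mono) (auto simp: finite_pool_obs)
  also have "\<dots> \<le> card (?O - ?R) + 1"
    by (metis add.commute card_insert_le_m1 card_insert_if finite_Diff finite_pool_obs le_add2 le_refl plus_1_eq_Suc)
  also have "\<dots> + card (?O \<inter> ?R) = card ?O + 1"
    using card_Diff_subset_Int[of ?O ?R] card_mono[of ?O "?O \<inter> ?R"] finite_pool_obs[of P n \<omega>] by auto
  finally show ?thesis by simp
qed


section \<open>Measurability of tip pools\<close>

text \<open>Statements about identifiers are translated into statements about extended reals, where
  equality of measurable functions is known to be measurable. The value \<open>- \<infinity>\<close> is left free to mark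
  positions beyond the end of a list.\<close>
fun tag :: "ident \<Rightarrow> ereal" where
  "tag Genesis = \<infinity>"
| "tag (Ident x) = ereal x"

definition entry :: "nat \<Rightarrow> ident list \<Rightarrow> ereal" where
  "entry i xs = (if i < length xs then tag (xs ! i) else - \<infinity>)"

lemma tag_eq_iff: "tag x = tag y \<longleftrightarrow> x = y"
  by (cases x; cases y) auto

lemma tag_neq_minf: "tag x \<noteq> - \<infinity>"
  by (cases x) auto

lemma mem_set_iff_entry: "x \<in> set xs \<longleftrightarrow> (\<exists>i. entry i xs = tag x)"
proof
  assume "x \<in> set xs"
  then show "\<exists>i. entry i xs = tag x" by (metis entry_def in_set_conv_nth)
next
  assume "\<exists>i. entry i xs = tag x"
  then obtain i where "entry i xs = tag x" ..
  then show "x \<in> set xs"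
    using tag_neq_minf[of x] by (auto simp: entry_def tag_eq_iff split: if_splits)
qed

lemma vimage_tag_sets:
  assumes "A \<in> sets borel" shows "tag -` A \<in> sets ident_space"
proof -
  have gen: "sets ident_space = sigma_sets UNIV (insert {Genesis} ((\<lambda>A. Ident ` A) ` sets borel))"
    by (simp add: ident_space_def)
  have 1: "Ident ` (ereal -` A) \<in> sets ident_space"
    unfolding gen using measurable_sets[OF borel_measurable_ereal[OF measurable_ident_sets[OF refl]] assms]
    by (intro sigma_sets.Basic) auto
  have 2: "{Genesis} \<in> sets ident_space"
    unfolding gen by (intro sigma_sets.Basic) auto
  have "x \<in> tag -` A \<longleftrightarrow> x \<in> Ident ` (ereal -` A) \<union> (if \<infinity> \<in> A then {Genesis} else {})" for x
    by (cases x) auto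
  then have "tag -` A = Ident ` (ereal -` A) \<union> (if \<infinity> \<in> A then {Genesis} else {})"
    by blast
  then show ?thesis using 1 sets.Un[OF 1 2] by (cases "\<infinity> \<in> A") simp_all
qed

lemma UNIV_ident_space: "UNIV \<in> sets ident_space"
  using sets.top[of ident_space] by (simp add: ident_space_def space_measure_of_conv)

lemma mem_listset_iff: "xs \<in> listset As \<longleftrightarrow> list_all2 (\<in>) xs As"
  by (induction As arbitrary: xs) (auto simp: set_Cons_def list_all2_Cons2)

lemma space_refs_space[simp]: "space refs_space = UNIV"
  by (simp add: refs_space_def space_measure_of_conv)

lemma listset_in_refs_space: "set As \<subseteq> sets ident_space \<Longrightarrow> listset As \<in> sets refs_space"
  by (auto simp: refs_space_def intro!: sigma_sets.Basic)

lemma length_eq_in_refs_space: "{xs :: ident list. length xs = n} \<in> sets refs_space"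
proof -
  have "{xs :: ident list. length xs = n} = listset (replicate n UNIV)"
    by (auto simp: mem_listset_iff list_all2_conv_all_nth)
  moreover have "listset (replicate n UNIV) \<in> sets refs_space"
    using UNIV_ident_space by (intro listset_in_refs_space) (auto simp: set_replicate_conv_if)
  ultimately show ?thesis by simp
qed

lemma measurable_length_refs[measurable]: "length \<in> measurable refs_space (count_space UNIV)"
  by (rule measurable_count_space_eq2_countable[THEN iffD2])
    (auto simp: vimage_def length_eq_in_refs_space)

lemma measurable_entry[measurable]: "entry i \<in> borel_measurable refs_space"
proof (rule measurableI)
  fix A :: "ereal set" assume A: "A \<in> sets borel"
  have 1: "{xs. length xs = n \<and> xs ! i \<in> tag -` A} \<in> sets refs_space" if "i < n" for n
  proof -
    have "{xs. length xs = n \<and> xs ! i \<in> tag -` A} = listset ((replicate n UNIV)[i := tag -` A])"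
      using that by (auto simp: mem_listset_iff list_all2_conv_all_nth nth_list_update split: if_splits)
    then show ?thesis
      using UNIV_ident_space vimage_tag_sets[OF A] set_update_subset_insert[of "replicate n UNIV" i "tag -` A"]
      by (auto intro!: listset_in_refs_space)
  qed
  have "{xs. length xs = n \<and> entry i xs \<in> A} \<in> sets refs_space" for n
  proof (cases "i < n")
    case True
    then have "{xs. length xs = n \<and> entry i xs \<in> A} = {xs. length xs = n \<and> xs ! i \<in> tag -` A}"
      by (auto simp: entry_def)
    then show ?thesis using 1[OF True] by simp
  next
    case False
    then have "{xs. length xs = n \<and> entry i xs \<in> A} = (if - \<infinity> \<in> A then {xs. length xs = n} else {})"
      by (auto simp: entry_def)
    then show ?thesis using length_eq_in_refs_space by simp
  qed
  then have "(\<Union>n. {xs. length xs = n \<and> entry i xs \<in> A}) \<in> sets refs_space"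
    by (intro sets.countable_UN) auto
  moreover have "entry i -` A \<inter> space refs_space = (\<Union>n. {xs. length xs = n \<and> entry i xs \<in> A})"
    by auto
  ultimately show "entry i -` A \<inter> space refs_space \<in> sets refs_space"
    by (simp only:)
qed simp

lemma distinct_iff_entry:
  "distinct xs \<longleftrightarrow> (\<forall>i j. i \<noteq> j \<longrightarrow> entry i xs = - \<infinity> \<or> entry i xs \<noteq> entry j xs)"
proof
  assume "distinct xs"
  then show "\<forall>i j. i \<noteq> j \<longrightarrow> entry i xs = - \<infinity> \<or> entry i xs \<noteq> entry j xs"
    unfolding distinct_conv_nth entry_def by (metis tag_eq_iff)
next
  assume "\<forall>i j. i \<noteq> j \<longrightarrow> entry i xs = - \<infinity> \<or> entry i xs \<noteq> entry j xs"
  then have *: "entry i xs = - \<infinity> \<or> entry i xs \<noteq> entry j xs" if "i \<noteq> j" for i j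
    using that by blast
  show "distinct xs"
    unfolding distinct_conv_nth
  proof (intro allI impI)
    fix i j assume "i < length xs" "j < length xs" "i \<noteq> j"
    then show "xs ! i \<noteq> xs ! j"
      using *[of i j] tag_neq_minf[of "xs ! i"] by (simp only: entry_def if_True tag_eq_iff) simp
  qed
qed

text \<open>Block index 0 stands for the genesis block here.\<close>
definition cand :: "('w, 'v) block_process \<Rightarrow> nat \<Rightarrow> 'w \<Rightarrow> ident" where
  "cand P m \<omega> = (if m = 0 then Genesis else Ident (blockID P m \<omega>))"

lemma pool_obs_eq_cand:
  "pool_obs P n \<omega> = (\<lambda>m. cand P m \<omega>) ` {m\<in>{..n}. \<forall>j\<in>{1..n}. cand P m \<omega> \<notin> set (refs P j \<omega>)}"
proof -
  have "{..n} = insert 0 {1..n}" by auto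
  then have "(\<lambda>m. cand P m \<omega>) ` {..n} = {Genesis} \<union> (\<lambda>m. cand P m \<omega>) ` {1..n}"
    by (simp add: cand_def[of P 0])
  also have "(\<lambda>m. cand P m \<omega>) ` {1..n} = (\<lambda>m. Ident (blockID P m \<omega>)) ` {1..n}"
    by (intro image_cong) (auto simp: cand_def)
  finally have "{Genesis} \<union> (\<lambda>m. Ident (blockID P m \<omega>)) ` {1..n} = (\<lambda>m. cand P m \<omega>) ` {..n}"
    by simp
  then show ?thesis
    unfolding pool_obs_def tips_def by (simp only:) blast
qed

lemma card_image_eq_card_first:
  fixes A :: "nat set"
  assumes "finite A"
  shows "card (f ` A) = card {m\<in>A. \<forall>l\<in>A. l < m \<longrightarrow> f l \<noteq> f m}"
proof -
  let ?B = "{m\<in>A. \<forall>l\<in>A. l < m \<longrightarrow> f l \<noteq> f m}"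
  have inj: "inj_on f ?B"
    by (rule inj_onI) (metis (mono_tags, lifting) linorder_neqE_nat mem_Collect_eq)
  have "f ` ?B = f ` A"
  proof (intro equalityI subsetI)
    fix y assume "y \<in> f ` A"
    then have ex: "\<exists>m. m \<in> A \<and> f m = y" by auto
    define m where "m = (LEAST m. m \<in> A \<and> f m = y)"
    have "m \<in> A \<and> f m = y" unfolding m_def by (rule LeastI_ex[OF ex])
    moreover have "l \<in> A \<Longrightarrow> l < m \<Longrightarrow> f l \<noteq> y" for l
      unfolding m_def using not_less_Least by blast
    ultimately show "y \<in> f ` ?B" by auto
  qed auto
  then show ?thesis using card_image[OF inj] by simp
qed

text \<open>Counting only the first index of each identifier turns the cardinality of a random set into a
  finite sum of indicators of measurable events.\<close>
lemma card_pool_obs_eq_sum: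
  "card (pool_obs P n \<omega>) = (\<Sum>m\<le>n. if (\<forall>j\<in>{1..n}. \<forall>i. entry i (refs P j \<omega>) \<noteq> tag (cand P m \<omega>))
      \<and> (\<forall>l<m. tag (cand P l \<omega>) \<noteq> tag (cand P m \<omega>)) then 1 else 0)"
proof -
  let ?T = "{m\<in>{..n}. \<forall>j\<in>{1..n}. cand P m \<omega> \<notin> set (refs P j \<omega>)}"
  have "card (pool_obs P n \<omega>) = card {m\<in>?T. \<forall>l\<in>?T. l < m \<longrightarrow> cand P l \<omega> \<noteq> cand P m \<omega>}"
    unfolding pool_obs_eq_cand by (rule card_image_eq_card_first) simp
  also have "{m\<in>?T. \<forall>l\<in>?T. l < m \<longrightarrow> cand P l \<omega> \<noteq> cand P m \<omega>}
     = {m\<in>?T. \<forall>l<m. cand P l \<omega> \<noteq> cand P m \<omega>}"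
  proof (intro Collect_cong conj_cong refl)
    fix m assume m: "m \<in> ?T"
    have "l \<in> ?T" if "l < m" "cand P l \<omega> = cand P m \<omega>" for l
      using m that by simp
    then show "(\<forall>l\<in>?T. l < m \<longrightarrow> cand P l \<omega> \<noteq> cand P m \<omega>) = (\<forall>l<m. cand P l \<omega> \<noteq> cand P m \<omega>)"
      by blast
  qed
  also have "\<dots> = {..n} \<inter> {m. (\<forall>j\<in>{1..n}. \<forall>i. entry i (refs P j \<omega>) \<noteq> tag (cand P m \<omega>))
      \<and> (\<forall>l<m. tag (cand P l \<omega>) \<noteq> tag (cand P m \<omega>))}"
    by (auto simp: mem_set_iff_entry tag_eq_iff)
  finally show ?thesis by (simp add: sum.If_cases)
qed

lemma hist_generator_closed:
  "((\<Union>m\<in>{1..a}. events_of M (time P m) borel \<union> events_of M (blockID P m) borel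
          \<union> events_of M (nodeID P m) (count_space UNIV))
      \<union> (\<Union>m\<in>{1..b}. events_of M (delay P m) delay_space)
      \<union> (\<Union>m\<in>{1..c}. events_of M (refs P m) refs_space)) \<subseteq> Pow (space M)"
  by (auto simp: events_of_def)

lemma space_hist[simp]: "space (hist M P a b c) = space M"
  unfolding hist_def using hist_generator_closed by (rule space_measure_of)

lemma sets_hist: "sets (hist M P a b c) = sigma_sets (space M)
     ((\<Union>m\<in>{1..a}. events_of M (time P m) borel \<union> events_of M (blockID P m) borel
          \<union> events_of M (nodeID P m) (count_space UNIV))
      \<union> (\<Union>m\<in>{1..b}. events_of M (delay P m) delay_space)
      \<union> (\<Union>m\<in>{1..c}. events_of M (refs P m) refs_space))"
  unfolding hist_def using hist_generator_closed by (rule sets_measure_of)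

lemma measurable_hist:
  shows measurable_time_hist: "m \<in> {1..a} \<Longrightarrow> time P m \<in> borel_measurable (hist M P a b c)"
    and measurable_blockID_hist: "m \<in> {1..a} \<Longrightarrow> blockID P m \<in> borel_measurable (hist M P a b c)"
    and measurable_refs_hist: "m \<in> {1..c} \<Longrightarrow> refs P m \<in> measurable (hist M P a b c) refs_space"
proof -
  show "m \<in> {1..a} \<Longrightarrow> time P m \<in> borel_measurable (hist M P a b c)"
    by (rule measurableI) (auto simp: sets_hist events_of_def intro!: sigma_sets.Basic)
  show "m \<in> {1..a} \<Longrightarrow> blockID P m \<in> borel_measurable (hist M P a b c)"
    by (rule measurableI) (auto simp: sets_hist events_of_def intro!: sigma_sets.Basic)
  show "m \<in> {1..c} \<Longrightarrow> refs P m \<in> measurable (hist M P a b c) refs_space"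
    by (rule measurableI) (auto simp: sets_hist events_of_def intro!: sigma_sets.Basic)
qed

lemma measurable_tag_cand_hist:
  assumes "m \<le> a" shows "(\<lambda>\<omega>. tag (cand P m \<omega>)) \<in> borel_measurable (hist M P a b c)"
proof (cases "m = 0")
  case False
  then have [measurable]: "blockID P m \<in> borel_measurable (hist M P a b c)"
    using assms by (intro measurable_blockID_hist) auto
  show ?thesis using False by (simp add: cand_def)
qed (simp add: cand_def)

lemma measurable_entry_refs_hist:
  "m \<in> {1..c} \<Longrightarrow> (\<lambda>\<omega>. entry i (refs P m \<omega>)) \<in> borel_measurable (hist M P a b c)"
  using measurable_compose[OF measurable_refs_hist measurable_entry] by blast

lemma measurable_card_pool_obs_hist:
  assumes "n \<le> a" "n \<le> c"
  shows "(\<lambda>\<omega>. card (pool_obs P n \<omega>)) \<in> measurable (hist M P a b c) (count_space UNIV)"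
proof -
  have cand: "(\<lambda>\<omega>. tag (cand P m \<omega>)) \<in> borel_measurable (hist M P a b c)" if "m \<le> n" for m
    using that assms by (intro measurable_tag_cand_hist) auto
  have entry: "(\<lambda>\<omega>. entry i (refs P m \<omega>)) \<in> borel_measurable (hist M P a b c)"
    if "m \<in> {1..n}" for m i
    using that assms by (intro measurable_entry_refs_hist) auto
  have tip: "Measurable.pred (hist M P a b c) (\<lambda>\<omega>. (\<forall>j\<in>{1..n}. \<forall>i. entry i (refs P j \<omega>) \<noteq> tag (cand P m \<omega>))
      \<and> (\<forall>l\<in>{..<m}. tag (cand P l \<omega>) \<noteq> tag (cand P m \<omega>)))" if "m \<le> n" for m
  proof (intro pred_intros_logic pred_intros_finite pred_intros_countable finite_atLeastAtMost finite_lessThan)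
    show "Measurable.pred (hist M P a b c) (\<lambda>\<omega>. entry i (refs P j \<omega>) = tag (cand P m \<omega>))"
      if "j \<in> {1..n}" for i j
      using that \<open>m \<le> n\<close> unfolding pred_def by (intro borel_measurable_eq cand entry) auto
    show "Measurable.pred (hist M P a b c) (\<lambda>\<omega>. tag (cand P l \<omega>) = tag (cand P m \<omega>))"
      if "l \<in> {..<m}" for l
      using that \<open>m \<le> n\<close> unfolding pred_def by (intro borel_measurable_eq cand) auto
  qed
  show ?thesis
    unfolding card_pool_obs_eq_sum lessThan_iff[symmetric] Ball_def[symmetric]
  proof (intro measurable_sum_nat measurable_If)
    fix m assume "m \<in> {..n}"
    then show "{\<omega> \<in> space (hist M P a b c). (\<forall>j\<in>{1..n}. \<forall>i. entry i (refs P j \<omega>) \<noteq> tag (cand P m \<omega>))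
      \<and> (\<forall>l\<in>{..<m}. tag (cand P l \<omega>) \<noteq> tag (cand P m \<omega>))} \<in> sets (hist M P a b c)"
      using tip[of m] by (simp add: pred_def)
  qed simp_all
qed

text \<open>The random set of reference lists that do not guarantee a loss of two observer tips.\<close>
lemma unclean_samples_measurable:
  assumes "n \<le> a" "n \<le> c"
  shows "{(\<omega>, xs). \<omega> \<in> space M \<and> \<not> (distinct xs \<and> 2 \<le> length xs \<and> set xs \<subseteq> pool_obs P n \<omega>)}
     \<in> sets (hist M P a b c \<Otimes>\<^sub>M refs_space)" (is "?C \<in> sets ?N")
proof -
  have 1[measurable]: "(\<lambda>z. tag (cand P m (fst z))) \<in> borel_measurable ?N" if "m \<le> n" for m
    using that assms by (intro measurable_compose[OF measurable_fst measurable_tag_cand_hist]) auto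
  have 2[measurable]: "(\<lambda>z. entry i (refs P m (fst z))) \<in> borel_measurable ?N"
    if "m \<in> {1..n}" for m i
    using that assms by (intro measurable_compose[OF measurable_fst measurable_entry_refs_hist]) auto
  let ?tip = "\<lambda>e \<omega>. \<exists>m\<in>{..n}. tag (cand P m \<omega>) = e \<and>
         (\<forall>j\<in>{1..n}. \<forall>i. entry i (refs P j \<omega>) \<noteq> tag (cand P m \<omega>))"
  have tip: "e \<in> pool_obs P n \<omega> \<longleftrightarrow> ?tip (tag e) \<omega>" for e \<omega>
    unfolding pool_obs_eq_cand by (auto simp: mem_set_iff_entry tag_eq_iff)
  have sub: "set xs \<subseteq> pool_obs P n \<omega> \<longleftrightarrow> (\<forall>i. entry i xs = - \<infinity> \<or> ?tip (entry i xs) \<omega>)" for xs \<omega>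
  proof -
    have "set xs \<subseteq> pool_obs P n \<omega> \<longleftrightarrow> (\<forall>i<length xs. ?tip (tag (xs ! i)) \<omega>)"
      unfolding tip[symmetric] by (auto simp: set_conv_nth)
    also have "\<dots> \<longleftrightarrow> (\<forall>i. entry i xs = - \<infinity> \<or> ?tip (entry i xs) \<omega>)"
    proof (rule all_cong1)
      fix i
      show "(i < length xs \<longrightarrow> ?tip (tag (xs ! i)) \<omega>) = (entry i xs = - \<infinity> \<or> ?tip (entry i xs) \<omega>)"
        by (cases "i < length xs") (simp_all only: entry_def[of i xs] tag_neq_minf if_True if_False simp_thms)
    qed
    finally show ?thesis .
  qed
  have "Measurable.pred ?N (\<lambda>z. \<not> (distinct (snd z) \<and> 2 \<le> length (snd z) \<and> set (snd z) \<subseteq> pool_obs P n (fst z)))"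
    unfolding distinct_iff_entry sub
    proof (intro pred_intros_logic pred_intros_finite pred_intros_countable finite_atLeastAtMost finite_atMost)
      show "Measurable.pred ?N (\<lambda>z. tag (cand P m (fst z)) = entry i (snd z))"
        if "m \<in> {..n}" for i m
        using that unfolding pred_def by (intro borel_measurable_eq) auto
      show "Measurable.pred ?N (\<lambda>z. entry i (refs P j (fst z)) = tag (cand P m (fst z)))"
        if "m \<in> {..n}" "j \<in> {1..n}" for i j m
        using that unfolding pred_def by (intro borel_measurable_eq) auto
    qed measurable
  moreover have "?C = {z\<in>space ?N. \<not> (distinct (snd z) \<and> 2 \<le> length (snd z) \<and> set (snd z) \<subseteq> pool_obs P n (fst z))}"
    by (auto simp: space_pair_measure)
  ultimately show ?thesis by (simp add: pred_def)
qed


section \<open>Almost sure properties of the process\<close>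

definition recent :: "('w, 'v) block_process \<Rightarrow> real \<Rightarrow> nat \<Rightarrow> 'w \<Rightarrow> nat set" where
  "recent P Delta n \<omega> = {m \<in> {1..<n}. time P n \<omega> - Delta < time P m \<omega>}"

lemma finite_recent: "finite (recent P Delta n \<omega>)"
  by (simp add: recent_def)

lemma card_recent_less:
  assumes "n \<ge> 1" shows "card (recent P Delta n \<omega>) < n"
proof -
  have "card (recent P Delta n \<omega>) \<le> card {1..<n}"
    by (rule card_mono) (auto simp: recent_def)
  then show ?thesis using assms by simp
qed

text \<open>The recent blocks are the last ones before \<open>n\<close>, so the earliest of them has index
  \<open>n - card (recent P Delta n \<omega>)\<close> or less.\<close>
lemma recent_nonempty_time:
  assumes mono: "\<And>m. time P m \<omega> \<le> time P (Suc m) \<omega>" and ne: "recent P Delta n \<omega> \<noteq> {}"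
  shows "time P n \<omega> - time P (n - card (recent P Delta n \<omega>)) \<omega> < Delta"
proof -
  let ?m = "Min (recent P Delta n \<omega>)"
  have m: "?m \<in> recent P Delta n \<omega>"
    using Min_in[OF finite_recent ne] .
  have "recent P Delta n \<omega> \<subseteq> {?m..<n}"
    using Min_le[OF finite_recent[of P Delta n \<omega>]] by (auto simp: recent_def)
  then have "card (recent P Delta n \<omega>) \<le> n - ?m"
    using card_mono[of "{?m..<n}"] by fastforce
  then have "?m \<le> n - card (recent P Delta n \<omega>)"
    using m by (auto simp: recent_def)
  then have "time P ?m \<omega> \<le> time P (n - card (recent P Delta n \<omega>)) \<omega>"
    by (rule lift_Suc_mono_le[of "\<lambda>m. time P m \<omega>", OF mono])
  then show ?thesis using m by (auto simp: recent_def)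
qed

lemma measurable_card_recent:
  assumes t: "\<And>m. m \<in> {1..n} \<Longrightarrow> time P m \<in> borel_measurable N"
  shows "(\<lambda>\<omega>. card (recent P Delta n \<omega>)) \<in> measurable N (count_space UNIV)"
proof (cases "n = 0")
  case False
  have "Measurable.pred N (\<lambda>\<omega>. time P n \<omega> - Delta < time P m \<omega>)" if "m \<in> {1..<n}" for m
  proof -
    have [measurable]: "time P n \<in> borel_measurable N" "time P m \<in> borel_measurable N"
      using that t[of n] t[of m] by auto
    show ?thesis by measurable
  qed
  then have "(\<lambda>\<omega>. \<Sum>m\<in>{1..<n}. if time P n \<omega> - Delta < time P m \<omega> then 1 else 0 :: nat)
      \<in> measurable N (count_space UNIV)"
    by (intro measurable_sum_nat measurable_If) (auto simp: pred_def)
  also have "(\<lambda>\<omega>. \<Sum>m\<in>{1..<n}. if time P n \<omega> - Delta < time P m \<omega> then 1 else 0 :: nat)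
      = (\<lambda>\<omega>. card (recent P Delta n \<omega>))"
    by (auto simp: recent_def sum.If_cases Int_def)
  finally show ?thesis .
qed (simp add: recent_def)

lemma events_of_subset_sets: "X \<in> measurable M S \<Longrightarrow> events_of M X S \<subseteq> sets M"
  by (auto simp: events_of_def)

context block_model
begin

lemma measurable_block_process:
  shows measurable_time[measurable]: "time P n \<in> borel_measurable M"
    and measurable_blockID: "n \<ge> 1 \<Longrightarrow> blockID P n \<in> borel_measurable M"
    and measurable_nodeID: "n \<ge> 1 \<Longrightarrow> nodeID P n \<in> measurable M (count_space UNIV)"
    and measurable_delay: "n \<ge> 1 \<Longrightarrow> delay P n \<in> measurable M delay_space"
    and measurable_refs: "n \<ge> 1 \<Longrightarrow> refs P n \<in> measurable M refs_space"
proof -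
  have gap: "gap (time P) n \<in> borel_measurable M" if "n \<ge> 1" for n
    using poisson that by (auto simp: poisson_arrivals_def iid_def indep_vars_def)
  show "time P n \<in> borel_measurable M"
  proof (induction n)
    case 0
    show ?case
      using poisson by (subst measurable_cong[where g="\<lambda>_. 0"]) (auto simp: poisson_arrivals_def)
  next
    case (Suc n)
    have "time P (Suc n) = (\<lambda>\<omega>. time P n \<omega> + gap (time P) (Suc n) \<omega>)"
      by (simp add: gap_def)
    moreover have "(\<lambda>\<omega>. time P n \<omega> + gap (time P) (Suc n) \<omega>) \<in> borel_measurable M"
      using Suc gap[of "Suc n"] by measurable
    ultimately show ?case by simp
  qed
  show "blockID P n \<in> borel_measurable M" if "n \<ge> 1"
    using blockID_iid that
      measurable_cong_sets[of M M "uniform_measure lborel {0..1}" "borel :: real measure"]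
    by (auto simp: iid_def indep_vars_def)
  show "nodeID P n \<in> measurable M (count_space UNIV)" if "n \<ge> 1"
    using nodeID_iid that by (auto simp: iid_def indep_vars_def)
  show "delay P n \<in> measurable M delay_space" if "n \<ge> 1"
    using delay_law[OF that] by (simp add: cond_law_def)
  show "refs P n \<in> measurable M refs_space" if "n \<ge> 1"
    using refs_law[OF that] by (simp add: cond_law_def)
qed

lemma subalgebra_hist: "subalgebra M (hist M P a b c)"
proof -
  have "sets (hist M P a b c) \<subseteq> sets M"
    unfolding sets_hist
    by (intro sets.sigma_sets_subset Un_least UN_least events_of_subset_sets measurable_block_process) auto
  then show ?thesis by (simp add: subalgebra_def)
qed

lemma finite_measure_subalgebra_hist: "finite_measure_subalgebra M (hist M P a b c)"
  by unfold_locales (rule subalgebra_hist)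

lemma AE_length_refs: "AE \<omega> in M. \<forall>n\<ge>1. length (refs P n \<omega>) \<le> k"
proof -
  have "AE \<omega> in M. n \<ge> 1 \<longrightarrow> length (refs P n \<omega>) \<le> k" for n
  proof (cases "n \<ge> 1")
    case True
    have "{xs :: ident list. length xs \<le> k} = length -` {..k} \<inter> space refs_space" by auto
    then have B: "{xs :: ident list. length xs \<le> k} \<in> sets refs_space"
      using measurable_sets[OF measurable_length_refs, of "{..k}"] by simp
    have "AE \<omega> in M. refs P n \<omega> \<in> {xs. length xs \<le> k}"
    proof (rule cond_law_AE_mem[OF prob_space_axioms finite_measure_subalgebra_hist refs_law[OF True] B])
      fix \<omega>
      let ?U = "pool_pre P n (nodeID P n \<omega>) \<omega>"
      show "prob_space (measure_pmf (pmf_of_set (samples k ?U)))"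
        by (rule measure_pmf.prob_space_axioms)
      have "finite ?U" by (simp add: pool_pre_def finite_tips)
      then show "emeasure (measure_pmf (pmf_of_set (samples k ?U))) {xs. length xs \<le> k} = 1"
        by (intro measure_pmf.emeasure_eq_1_AE)
          (simp_all add: AE_measure_pmf_iff finite_samples samples_nonempty, simp add: samples_def)
    qed
    then show ?thesis by auto
  qed simp
  then show ?thesis by (simp add: AE_all_countable)
qed

lemma AE_delay_le: "AE \<omega> in M. \<forall>n\<ge>1. \<forall>i. delay P n \<omega> i \<le> Delta"
proof -
  have "AE \<omega> in M. n \<ge> 1 \<longrightarrow> delay P n \<omega> i \<le> Delta" for n i
  proof (cases "n \<ge> 1")
    case True
    let ?B = "{d\<in>space delay_space. d i \<le> Delta}"
    have B: "?B \<in> sets delay_space" by measurable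
    have "AE \<omega> in M. delay P n \<omega> \<in> ?B"
    proof (rule cond_law_AE_mem[OF prob_space_axioms finite_measure_subalgebra_hist delay_law[OF True] B D_prob])
      fix \<omega>
      interpret D: prob_space "D (nodeID P n \<omega>)" by (rule D_prob)
      show "emeasure (D (nodeID P n \<omega>)) ?B = 1"
        using partial_synchrony[where i="nodeID P n \<omega>" and j=i] B D_sets
        by (intro D.emeasure_eq_1_AE) (auto simp: space_PiM)
    qed
    then show ?thesis by auto
  qed simp
  then show ?thesis by (simp add: AE_all_countable AE_finite_all)
qed


section \<open>Exponential moments of the number of recent blocks\<close>

lemma gap_distr:
  "n \<ge> 1 \<Longrightarrow> distr M (density lborel (exponential_density rate)) (gap (time P) n)
    = density lborel (exponential_density rate)"
  using poisson by (simp add: poisson_arrivals_def iid_def)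

lemma measurable_gap:
  "gap (time P) n \<in> measurable M (density lborel (exponential_density rate))"
  by (simp add: gap_def[abs_def])

lemma AE_time_mono: "AE \<omega> in M. \<forall>n. time P n \<omega> \<le> time P (Suc n) \<omega>"
proof -
  have "AE \<omega> in M. 0 \<le> gap (time P) (Suc n) \<omega>" for n
  proof -
    have "AE x in density lborel (exponential_density rate). 0 \<le> x"
      by (subst AE_density) (auto simp: exponential_density_def)
    then have "AE x in distr M (density lborel (exponential_density rate)) (gap (time P) (Suc n)). 0 \<le> x"
      by (subst gap_distr) simp_all
    then show ?thesis
      by (subst (asm) AE_distr_iff[OF measurable_gap]) auto
  qed
  then show ?thesis by (simp add: AE_all_countable gap_def)
qed

text \<open>Exponential tilting: \<open>exp (- s * x)\<close> turns the density of rate \<open>rate\<close> into that of rate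
  \<open>rate + s\<close>, up to the constant.\<close>
lemma laplace_gap:
  assumes "n \<ge> 1" "s \<ge> 0"
  shows "(\<integral>\<^sup>+\<omega>. ennreal (exp (- s * gap (time P) n \<omega>)) \<partial>M) = ennreal (rate / (rate + s))"
proof -
  let ?E = "density lborel (exponential_density rate)"
  have pos: "0 < rate + s" using rate_pos assms by simp
  have "(\<integral>\<^sup>+\<omega>. ennreal (exp (- s * gap (time P) n \<omega>)) \<partial>M)
      = (\<integral>\<^sup>+x. ennreal (exp (- s * x)) \<partial>distr M ?E (gap (time P) n))"
    by (rule nn_integral_distr[symmetric, OF measurable_gap]) simp
  also have "\<dots> = (\<integral>\<^sup>+x. ennreal (exponential_density rate x) * ennreal (exp (- s * x)) \<partial>lborel)"
    using assms by (simp add: gap_distr nn_integral_density)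
  also have "\<dots> = (\<integral>\<^sup>+x. ennreal (rate / (rate + s)) * ennreal (exponential_density (rate + s) x) \<partial>lborel)"
  proof (rule nn_integral_cong)
    fix x :: real
    have "exp (- x * rate) * exp (- s * x) = exp (- x * (rate + s))"
      by (simp add: exp_add[symmetric] algebra_simps)
    then show "ennreal (exponential_density rate x) * ennreal (exp (- s * x))
        = ennreal (rate / (rate + s)) * ennreal (exponential_density (rate + s) x)"
      using pos rate_pos by (simp add: exponential_density_def ennreal_mult[symmetric] mult.assoc)
  qed
  also have "\<dots> = ennreal (rate / (rate + s)) * emeasure (density lborel (exponential_density (rate + s))) UNIV"
    by (simp add: nn_integral_cmult emeasure_density)
  also have "\<dots> = ennreal (rate / (rate + s))"
    using prob_space.emeasure_space_1[OF prob_space_exponential_density[OF pos]] by simp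
  finally show ?thesis .
qed

lemma laplace_time_diff:
  assumes "l \<le> n" "s \<ge> 0"
  shows "(\<integral>\<^sup>+\<omega>. ennreal (exp (- s * (time P n \<omega> - time P (n - l) \<omega>))) \<partial>M) = ennreal ((rate / (rate + s)) ^ l)"
proof -
  let ?J = "{n - l<..n}"
  have "time P n \<omega> - time P (n - l) \<omega> = (\<Sum>j\<in>?J. gap (time P) j \<omega>)" for \<omega>
  proof -
    have "time P m \<omega> - time P p \<omega> = (\<Sum>j\<in>{p<..m}. gap (time P) j \<omega>)" if "p \<le> m" for p m
      using that
    proof (induction m rule: dec_induct)
      case (step m)
      have "{p<..Suc m} = insert (Suc m) {p<..m}" using step by auto
      then show ?case using step by (simp add: gap_def)
    qed simp
    then show ?thesis by simp
  qed
  then have "(\<integral>\<^sup>+\<omega>. ennreal (exp (- s * (time P n \<omega> - time P (n - l) \<omega>))) \<partial>M)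
      = (\<integral>\<^sup>+\<omega>. (\<Prod>j\<in>?J. ennreal (exp (- s * gap (time P) j \<omega>))) \<partial>M)"
    by (simp add: sum_distrib_left exp_sum prod_ennreal sum_negf[symmetric])
  also have "\<dots> = (\<Prod>j\<in>?J. \<integral>\<^sup>+\<omega>. ennreal (exp (- s * gap (time P) j \<omega>)) \<partial>M)"
  proof (rule indep_vars_nn_integral)
    have "indep_vars (\<lambda>_. density lborel (exponential_density rate)) (gap (time P)) ?J"
      using poisson by (auto simp: poisson_arrivals_def iid_def intro: indep_vars_subset)
    then show "indep_vars (\<lambda>_. borel) (\<lambda>j \<omega>. ennreal (exp (- s * gap (time P) j \<omega>))) ?J"
      by (rule indep_vars_compose2[where Y="\<lambda>_ x. ennreal (exp (- s * x))"]) simp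
  qed simp_all
  also have "\<dots> = (\<Prod>j\<in>?J. ennreal (rate / (rate + s)))"
    using assms by (intro prod.cong refl laplace_gap) auto
  also have "\<dots> = ennreal ((rate / (rate + s)) ^ l)"
    using assms rate_pos by (simp add: ennreal_power)
  finally show ?thesis .
qed

text \<open>Exponential Markov inequality: if \<open>l\<close> blocks are recent then
  \<open>1 \<le> exp (s * (Delta - (time P n - time P (n - l))))\<close>, and the expectation of
  \<open>exp (- s * (time P n - time P (n - l)))\<close> is \<open>(rate / (rate + s)) ^ l\<close>. The parameter \<open>s\<close>
  can be taken so large that this beats \<open>z ^ l\<close>.\<close>
lemma exp_moment_recent:
  fixes z :: real
  assumes z: "z \<ge> 1"
  shows "\<exists>c. \<forall>n\<ge>1. (\<integral>\<^sup>+\<omega>. ennreal (z ^ card (recent P Delta n \<omega>)) \<partial>M) \<le> ennreal c"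
proof -
  \<comment> \<open>This choice makes \<open>z * rate / (rate + s)\<close> equal to \<open>1/2\<close>.\<close>
  define s where "s = rate * (2 * z - 1)"
  have s: "s \<ge> 0" using z rate_pos by (simp add: s_def)
  have q: "rate / (rate + s) = 1 / (2 * z)"
    using z rate_pos by (simp add: s_def field_simps)
  show ?thesis
  proof (intro exI allI impI)
    fix n :: nat assume n: "n \<ge> 1"
    let ?L = "\<lambda>\<omega>. card (recent P Delta n \<omega>)"
    let ?g = "\<lambda>l \<omega>. ennreal (exp (- s * (time P n \<omega> - time P (n - l) \<omega>)))"
    have "(\<integral>\<^sup>+\<omega>. ennreal (z ^ ?L \<omega>) \<partial>M)
        \<le> (\<integral>\<^sup>+\<omega>. 1 + (\<Sum>l\<in>{1..<n}. ennreal (z ^ l * exp (s * Delta)) * ?g l \<omega>) \<partial>M)"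
    proof (rule nn_integral_mono_AE)
      show "AE \<omega> in M. ennreal (z ^ ?L \<omega>)
          \<le> 1 + (\<Sum>l\<in>{1..<n}. ennreal (z ^ l * exp (s * Delta)) * ?g l \<omega>)"
        using AE_time_mono
      proof eventually_elim
        case (elim \<omega>)
        show ?case
        proof (cases "recent P Delta n \<omega> = {}")
          case False
          then have L: "?L \<omega> \<in> {1..<n}"
            using card_recent_less[OF n, of P Delta \<omega>] finite_recent[of P Delta n \<omega>]
            by (auto simp: Suc_le_eq card_gt_0_iff)
          have "s * (time P n \<omega> - time P (n - ?L \<omega>) \<omega>) \<le> s * Delta"
            using recent_nonempty_time[OF _ False] elim s by (intro mult_left_mono) auto
          then have "1 \<le> exp (s * Delta) * exp (- s * (time P n \<omega> - time P (n - ?L \<omega>) \<omega>))"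
            by (simp add: exp_add[symmetric])
          then have "z ^ ?L \<omega> * 1 \<le> z ^ ?L \<omega> * (exp (s * Delta) * exp (- s * (time P n \<omega> - time P (n - ?L \<omega>) \<omega>)))"
            using z by (intro mult_left_mono) auto
          then have "ennreal (z ^ ?L \<omega>) \<le> ennreal (z ^ ?L \<omega> * exp (s * Delta)) * ?g (?L \<omega>) \<omega>"
            using z by (simp add: ennreal_mult[symmetric] mult.assoc ennreal_leI)
          also have "\<dots> \<le> (\<Sum>l\<in>{1..<n}. ennreal (z ^ l * exp (s * Delta)) * ?g l \<omega>)"
            by (rule member_le_sum[OF L]) auto
          also have "\<dots> \<le> 1 + \<dots>" by simp
          finally show ?thesis .
        qed simp
      qed
    qed
    also have "\<dots> = 1 + (\<Sum>l\<in>{1..<n}. ennreal (z ^ l * exp (s * Delta)) * (\<integral>\<^sup>+\<omega>. ?g l \<omega> \<partial>M))"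
      by (simp add: nn_integral_add nn_integral_sum nn_integral_cmult emeasure_space_1)
    also have "\<dots> = 1 + (\<Sum>l\<in>{1..<n}. ennreal (exp (s * Delta) * (1/2) ^ l))"
    proof -
      have "ennreal (z ^ l * exp (s * Delta)) * (\<integral>\<^sup>+\<omega>. ?g l \<omega> \<partial>M) = ennreal (exp (s * Delta) * (1/2) ^ l)"
        if "l \<in> {1..<n}" for l
        using z that s by (subst laplace_time_diff)
          (auto simp: q ennreal_mult[symmetric] power_divide power_mult_distrib)
      then show ?thesis by simp
    qed
    also have "\<dots> = ennreal (1 + exp (s * Delta) * (\<Sum>l\<in>{1..<n}. (1/2) ^ l))"
      by (simp add: sum_ennreal sum_distrib_left sum_nonneg)
    also have "\<dots> \<le> ennreal (1 + exp (s * Delta) * 2)"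
    proof -
      have "(\<Sum>l\<in>{1..<n}. (1/2::real) ^ l) \<le> (\<Sum>l<n. (1/2) ^ l)"
        by (rule sum_mono2) auto
      also have "\<dots> \<le> 2" by (subst geometric_sum) auto
      finally show ?thesis by (intro ennreal_leI add_left_mono mult_left_mono) auto
    qed
    finally show "(\<integral>\<^sup>+\<omega>. ennreal (z ^ ?L \<omega>) \<partial>M) \<le> ennreal (1 + exp (s * Delta) * 2)" .
  qed
qed


section \<open>Drift of the observer tip pool\<close>

text \<open>The almost sure properties of a path on which the comparison of local pools with the
  observer pool rests.\<close>
definition reliable :: "'w \<Rightarrow> bool" where
  "reliable \<omega> \<longleftrightarrow> (\<forall>n\<ge>1. length (refs P n \<omega>) \<le> k) \<and> (\<forall>n\<ge>1. \<forall>i. delay P n \<omega> i \<le> Delta)"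

lemma AE_reliable: "AE \<omega> in M. reliable \<omega>"
  using AE_length_refs AE_delay_le by eventually_elim (simp add: reliable_def)

lemma unknown_subset_recent:
  assumes "reliable \<omega>"
  shows "{1..<n} - {m \<in> {1..<n}. time P m \<omega> + delay P m \<omega> i \<le> time P n \<omega>} \<subseteq> recent P Delta n \<omega>"
proof
  fix m assume m: "m \<in> {1..<n} - {m \<in> {1..<n}. time P m \<omega> + delay P m \<omega> i \<le> time P n \<omega>}"
  then have "delay P m \<omega> i \<le> Delta" using assms by (auto simp: reliable_def)
  with m show "m \<in> recent P Delta n \<omega>" by (auto simp: recent_def)
qed

text \<open>After issuance of block \<open>n\<close> at time \<open>t\<close>, node \<open>i\<close> can be ignorant of the recent blocks and of
  block \<open>n\<close> itself; this accounts for the summand 1.\<close>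
lemma card_pool_le:
  assumes "reliable \<omega>"
  shows "card (pool P n i \<omega>) \<le> card (pool_obs P n \<omega>) + k * (card (recent P Delta n \<omega>) + 1)"
proof -
  let ?S = "{m \<in> {1..n}. time P m \<omega> + delay P m \<omega> i \<le> time P n \<omega>}"
  have "{1..n} - ?S \<subseteq> insert n (recent P Delta n \<omega>)"
    using unknown_subset_recent[OF assms, of n i] by force
  then have "card ({1..n} - ?S) \<le> card (insert n (recent P Delta n \<omega>))"
    by (intro card_mono) (auto simp: finite_recent)
  also have "\<dots> \<le> card (recent P Delta n \<omega>) + 1"
    by (simp add: card_insert_if finite_recent)
  finally have "card ({1..n} - ?S) \<le> card (recent P Delta n \<omega>) + 1" .
  then have "k * card ({1..n} - ?S) \<le> k * (card (recent P Delta n \<omega>) + 1)"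
    by (rule mult_le_mono2)
  moreover have "card (pool P n i \<omega>) \<le> card (pool_obs P n \<omega>) + k * card ({1..n} - ?S)"
    unfolding pool_def pool_obs_def
    using assms by (intro card_tips_le_subset) (auto simp: reliable_def)
  ultimately show ?thesis by linarith
qed

text \<open>The event on which the pool has negative drift at step \<open>n + 1\<close>. Of the factor \<open>8 * k * k + 1\<close>,
  the summand 1 pays for the observer tips unknown to the issuer, and \<open>8 * k * k\<close> makes the obsolete
  tips, of which there are at most \<open>k\<close> per recent block, rare enough for a sample of at most \<open>k\<close> tips to
  avoid them with probability at least \<open>7/8\<close>. The bound 3 leaves the issuer at least two tips when no block
  is recent.\<close>
definition calm :: "nat \<Rightarrow> 'w \<Rightarrow> bool" where
  "calm n \<omega> \<longleftrightarrow> 3 \<le> card (pool_obs P n \<omega>)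
     \<and> (8 * k * k + 1) * card (recent P Delta (Suc n) \<omega>) \<le> card (pool_obs P n \<omega>)"

text \<open>On a calm step the issuer's pool satisfies the size condition of \<open>clean_sample_prob\<close> relative to
  the observer pool.\<close>
lemma calm_sample_prob:
  assumes rel: "reliable \<omega>" and calm: "calm n \<omega>"
  defines "U \<equiv> pool_pre P (Suc n) (nodeID P (Suc n) \<omega>) \<omega>"
  shows "emeasure (measure_pmf (pmf_of_set (samples k U)))
      {xs. \<not> (distinct xs \<and> 2 \<le> length xs \<and> set xs \<subseteq> pool_obs P n \<omega>)} \<le> ennreal (1/8)"
proof -
  let ?i = "nodeID P (Suc n) \<omega>" and ?R = "recent P Delta (Suc n) \<omega>" and ?O = "pool_obs P n \<omega>"
  let ?S = "{m \<in> {1..<Suc n}. time P m \<omega> + delay P m \<omega> ?i \<le> time P (Suc n) \<omega>}"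
  have U: "U = tips P \<omega> ?S" by (simp add: U_def pool_pre_def)
  have O: "?O = tips P \<omega> {1..<Suc n}"
    by (simp add: pool_obs_def atLeastLessThanSuc_atLeastAtMost)
  have "card ({1..<Suc n} - ?S) \<le> card ?R"
    by (intro card_mono finite_recent unknown_subset_recent rel)
  moreover have "card ?O \<le> card U + card ({1..<Suc n} - ?S)"
    unfolding U O by (rule card_tips_le_superset) auto
  ultimately have 1: "card ?O \<le> card U + card ?R" by linarith
  have "card (U - ?O) \<le> k * card ({1..<Suc n} - ?S)"
    unfolding U O using rel by (intro card_tips_diff_le) (auto simp: reliable_def)
  also have "\<dots> \<le> k * card ?R"
    using \<open>card ({1..<Suc n} - ?S) \<le> card ?R\<close> by simp
  finally have "8 * k * card (U - ?O) \<le> 8 * k * (k * card ?R)"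
    by (rule mult_le_mono2)
  then have W: "8 * k * card (U - ?O) \<le> 8 * k * k * card ?R"
    by (simp add: mult.assoc)
  have c: "8 * k * k * card ?R + card ?R \<le> card ?O" "3 \<le> card ?O"
    using calm by (auto simp: calm_def algebra_simps)
  have "card ?R \<le> 8 * k * k * card ?R" "card ?R = 0 \<or> 2 \<le> 8 * k * k * card ?R"
    using k_ge_2 by auto
  then have "2 \<le> card U" using c 1 by linarith
  moreover have "8 * k * card (U - ?O) \<le> card U" using W c(1) 1 by linarith
  moreover have "finite U" by (simp add: U finite_tips)
  ultimately show ?thesis using clean_sample_prob k_ge_2 by blast
qed

text \<open>Four cases bound \<open>2 ^ X (n + 1)\<close>: a small pool contributes at most \<open>2 ^ 3\<close>; a pool small
  relative to the recent blocks contributes the exponential moment of their number; on a calm step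
  the value drops to half or less, unless the sample contains an obsolete tip, which has conditional
  probability at most \<open>1/8\<close> and at most doubles the value. Thus \<open>3/4 = 1/2 + 2 * (1/8)\<close>.\<close>
lemma pool_obs_drift:
  shows "(\<integral>\<^sup>+\<omega>. ennreal (2 ^ card (pool_obs P (Suc n) \<omega>)) \<partial>M)
    \<le> 8 + 2 * (\<integral>\<^sup>+\<omega>. ennreal ((2 ^ (8 * k * k + 1)) ^ card (recent P Delta (Suc n) \<omega>)) \<partial>M)
      + ennreal (3/4) * (\<integral>\<^sup>+\<omega>. ennreal (2 ^ card (pool_obs P n \<omega>)) \<partial>M)"
proof -
  let ?X = "\<lambda>n \<omega>. card (pool_obs P n \<omega>)" and ?R = "\<lambda>\<omega>. card (recent P Delta (Suc n) \<omega>)"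
  let ?F = "hist M P (Suc n) (Suc n) n" and ?z = "2 ^ (8 * k * k + 1) :: real"
  let ?C = "{(\<omega>, xs). \<omega> \<in> space M \<and> \<not> (distinct xs \<and> 2 \<le> length xs \<and> set xs \<subseteq> pool_obs P n \<omega>)}"
  \<comment> \<open>The value before the step on the calm event; unlike the references drawn in the step, it
    is a function of the past.\<close>
  define h where "h \<omega> = (if calm n \<omega> then ennreal (2 ^ ?X n \<omega>) else 0)" for \<omega>
  have law: "cond_law M ?F (refs P (Suc n)) refs_space (\<lambda>\<omega>. measure_pmf (pmf_of_set
      (samples k (pool_pre P (Suc n) (nodeID P (Suc n) \<omega>) \<omega>))))"
    using refs_law[of "Suc n"] by simp
  have X[measurable]: "?X n \<in> measurable ?F (count_space UNIV)"
    by (rule measurable_card_pool_obs_hist) auto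
  have R[measurable]: "?R \<in> measurable ?F (count_space UNIV)"
    by (intro measurable_card_recent measurable_time_hist)
  have hF[measurable]: "h \<in> borel_measurable ?F"
    unfolding h_def[abs_def] calm_def
    by (rule measurable_compose_countable[OF measurable_compose_countable[OF _ R] X]) simp
  have hM[measurable]: "h \<in> borel_measurable M"
    by (rule measurable_from_subalg[OF subalgebra_hist hF])
  have RM[measurable]: "?R \<in> measurable M (count_space UNIV)"
    by (intro measurable_card_recent measurable_time)
  have C: "?C \<in> sets (?F \<Otimes>\<^sub>M refs_space)"
    by (rule unclean_samples_measurable) auto
  have [measurable]: "refs P (Suc n) \<in> measurable M refs_space"
    by (rule measurable_refs) simp
  have w: "(\<lambda>\<omega>. ennreal (?z ^ ?R \<omega>)) \<in> borel_measurable M"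
    by measurable
  have bad: "(\<lambda>\<omega>. indicator ?C (\<omega>, refs P (Suc n) \<omega>) :: ennreal) \<in> borel_measurable M"
  proof -
    have "(\<lambda>\<omega>. \<omega>) \<in> measurable M ?F"
      using subalgebra_hist[of "Suc n" "Suc n" n] by (auto simp: subalgebra_def measurable_def)
    then have "(\<lambda>\<omega>. (\<omega>, refs P (Suc n) \<omega>)) \<in> measurable M (?F \<Otimes>\<^sub>M refs_space)"
      by measurable
    from measurable_compose[OF this borel_measurable_indicator[OF C]] show ?thesis .
  qed
  have "AE \<omega> in M. ennreal (2 ^ ?X (Suc n) \<omega>) \<le> 8 + 2 * ennreal (?z ^ ?R \<omega>)
      + (ennreal (1/2) * h \<omega> + 2 * (h \<omega> * indicator ?C (\<omega>, refs P (Suc n) \<omega>)))"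
    using AE_space
  proof eventually_elim
    case (elim \<omega>)
    have step: "?X (Suc n) \<omega> + card (pool_obs P n \<omega> \<inter> set (refs P (Suc n) \<omega>)) \<le> ?X n \<omega> + 1"
      by (rule card_pool_obs_step)
    consider "?X n \<omega> < 3" | "3 \<le> ?X n \<omega>" "?X n \<omega> < (8 * k * k + 1) * ?R \<omega>"
      | "calm n \<omega>" "(\<omega>, refs P (Suc n) \<omega>) \<in> ?C" | "calm n \<omega>" "(\<omega>, refs P (Suc n) \<omega>) \<notin> ?C"
      unfolding calm_def by linarith
    then show ?case
    proof cases
      case 1
      then have "(2::real) ^ ?X (Suc n) \<omega> \<le> 2 ^ 3"
        using step by (intro power_increasing) auto
      then have "ennreal (2 ^ ?X (Suc n) \<omega>) \<le> 8"
        using ennreal_leI[of _ "8::real"] by simp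
      then show ?thesis
        by (meson add_increasing2 order_trans zero_le)
    next
      case 2
      have "(2::real) ^ ?X (Suc n) \<omega> \<le> 2 ^ ((8 * k * k + 1) * ?R \<omega> + 1)"
        using step 2 by (intro power_increasing) auto
      also have "\<dots> = 2 * ?z ^ ?R \<omega>"
      proof -
        have "(2::real) ^ (a * m + 1) = 2 * (2 ^ a) ^ m" for a m by (simp add: power_mult)
        then show ?thesis .
      qed
      finally have "ennreal (2 ^ ?X (Suc n) \<omega>) \<le> ennreal (2 * ?z ^ ?R \<omega>)"
        by (rule ennreal_leI)
      also have "\<dots> = 2 * ennreal (?z ^ ?R \<omega>)"
        by (simp add: ennreal_mult)
      also have "\<dots> \<le> 8 + \<dots>" by simp
      finally show ?thesis
        by (meson add_increasing2 order_trans zero_le)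
    next
      case 3
      have "(2::real) ^ ?X (Suc n) \<omega> \<le> 2 ^ (?X n \<omega> + 1)"
        using step by (intro power_increasing) auto
      then have "ennreal (2 ^ ?X (Suc n) \<omega>) \<le> ennreal (2 * 2 ^ ?X n \<omega>)"
        by (intro ennreal_leI) simp
      also have "\<dots> = 2 * (h \<omega> * indicator ?C (\<omega>, refs P (Suc n) \<omega>))"
        using 3 by (simp add: h_def ennreal_mult)
      finally show ?thesis
        by (meson add_increasing order_trans zero_le)
    next
      case 4
      then have "2 \<le> card (pool_obs P n \<omega> \<inter> set (refs P (Suc n) \<omega>))"
        using elim by (auto simp: Int_absorb1 distinct_card)
      then have "(2::real) ^ (?X (Suc n) \<omega> + 1) \<le> 2 ^ ?X n \<omega>"
        using step by (intro power_increasing) auto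
      then have "ennreal (2 ^ ?X (Suc n) \<omega>) \<le> ennreal (1/2 * 2 ^ ?X n \<omega>)"
        by (intro ennreal_leI) simp
      also have "\<dots> = ennreal (1/2) * h \<omega>"
        unfolding h_def using 4 by (subst ennreal_mult) auto
      finally show ?thesis
        by (meson add_increasing add_increasing2 order_trans zero_le)
    qed
  qed
  then have "(\<integral>\<^sup>+\<omega>. ennreal (2 ^ ?X (Suc n) \<omega>) \<partial>M) \<le> (\<integral>\<^sup>+\<omega>. 8 + 2 * ennreal (?z ^ ?R \<omega>)
      + (ennreal (1/2) * h \<omega> + 2 * (h \<omega> * indicator ?C (\<omega>, refs P (Suc n) \<omega>))) \<partial>M)"
    by (rule nn_integral_mono_AE)
  also have "\<dots> = 8 + 2 * (\<integral>\<^sup>+\<omega>. ennreal (?z ^ ?R \<omega>) \<partial>M)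
      + (ennreal (1/2) * (\<integral>\<^sup>+\<omega>. h \<omega> \<partial>M) + 2 * (\<integral>\<^sup>+\<omega>. h \<omega> * indicator ?C (\<omega>, refs P (Suc n) \<omega>) \<partial>M))"
  proof -
    have "(\<integral>\<^sup>+\<omega>. 8 + 2 * w \<omega> + (a * h \<omega> + 2 * (h \<omega> * g \<omega>)) \<partial>M)
        = 8 + 2 * (\<integral>\<^sup>+\<omega>. w \<omega> \<partial>M) + (a * (\<integral>\<^sup>+\<omega>. h \<omega> \<partial>M) + 2 * (\<integral>\<^sup>+\<omega>. h \<omega> * g \<omega> \<partial>M))"
      if [measurable]: "w \<in> borel_measurable M" "g \<in> borel_measurable M" for w g a
      by (simp add: nn_integral_add nn_integral_cmult emeasure_space_1)
    from this[OF w bad] show ?thesis .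
  qed
  also have "(\<integral>\<^sup>+\<omega>. h \<omega> * indicator ?C (\<omega>, refs P (Suc n) \<omega>) \<partial>M) \<le> ennreal (1/8) * (\<integral>\<^sup>+\<omega>. h \<omega> \<partial>M)"
  proof (rule cond_law_nn_integral_le[OF finite_measure_subalgebra_hist law C _ _ _ hF])
    show "AE \<omega> in M. h \<omega> \<noteq> 0 \<longrightarrow> emeasure (measure_pmf (pmf_of_set
        (samples k (pool_pre P (Suc n) (nodeID P (Suc n) \<omega>) \<omega>)))) (Pair \<omega> -` ?C) \<le> ennreal (1/8)"
      using AE_reliable AE_space
    proof eventually_elim
      case (elim \<omega>)
      then show ?case
        using calm_sample_prob[of \<omega> n] by (auto simp: h_def vimage_def)
    qed
  qed (simp_all add: measure_pmf.prob_space_axioms)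
  also have "ennreal (1/2) * (\<integral>\<^sup>+\<omega>. h \<omega> \<partial>M) + 2 * (ennreal (1/8) * (\<integral>\<^sup>+\<omega>. h \<omega> \<partial>M))
      = ennreal (3/4) * (\<integral>\<^sup>+\<omega>. h \<omega> \<partial>M)"
  proof -
    have "2 * ennreal (1/8) = ennreal (1/4)"
      using ennreal_mult[of 2 "1/8"] by simp
    moreover have "ennreal (1/2) + ennreal (1/4) = ennreal (3/4)"
      by (subst ennreal_plus[symmetric]) auto
    ultimately show ?thesis
      by (metis distrib_right mult.assoc)
  qed
  also have "(\<integral>\<^sup>+\<omega>. h \<omega> \<partial>M) \<le> (\<integral>\<^sup>+\<omega>. ennreal (2 ^ ?X n \<omega>) \<partial>M)"
    by (intro nn_integral_mono) (simp add: h_def)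
  finally show ?thesis
    by (simp add: add_left_mono mult_left_mono)
qed


section \<open>Moments of the tip pools\<close>

lemma exp_moment_pool_obs:
  "\<exists>c\<ge>0. \<forall>n. (\<integral>\<^sup>+\<omega>. ennreal (2 ^ card (pool_obs P n \<omega>)) \<partial>M) \<le> ennreal c"
proof -
  have "\<exists>b. \<forall>n\<ge>1.
      (\<integral>\<^sup>+\<omega>. ennreal ((2 ^ (8 * k * k + 1)) ^ card (recent P Delta n \<omega>)) \<partial>M) \<le> ennreal b"
    by (rule exp_moment_recent) (rule one_le_power, simp)
  then obtain b where b: "\<And>n. n \<ge> 1 \<Longrightarrow>
      (\<integral>\<^sup>+\<omega>. ennreal ((2 ^ (8 * k * k + 1)) ^ card (recent P Delta n \<omega>)) \<partial>M) \<le> ennreal b"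
    by blast
  define B where "B = max b 0"
  have B: "0 \<le> B" "b \<le> B" by (simp_all add: B_def)
  \<comment> \<open>The fixed point of \<open>x \<mapsto> 8 + 2 * B + 3/4 * x\<close>.\<close>
  define c where "c = 4 * (8 + 2 * B)"
  have "(\<integral>\<^sup>+\<omega>. ennreal (2 ^ card (pool_obs P n \<omega>)) \<partial>M) \<le> ennreal c" for n
  proof (induction n)
    case 0
    have "(\<integral>\<^sup>+\<omega>. ennreal (2 ^ card (pool_obs P 0 \<omega>)) \<partial>M) = ennreal 2"
      by (simp add: card_pool_obs_0 emeasure_space_1)
    also have "\<dots> \<le> ennreal c" by (rule ennreal_leI) (use B in \<open>simp add: c_def\<close>)
    finally show ?case .
  next
    case (Suc n)
    have "(\<integral>\<^sup>+\<omega>. ennreal ((2 ^ (8 * k * k + 1)) ^ card (recent P Delta (Suc n) \<omega>)) \<partial>M) \<le> ennreal B"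
      by (rule order_trans[OF b ennreal_leI]) (auto simp: B)
    then have "(\<integral>\<^sup>+\<omega>. ennreal (2 ^ card (pool_obs P (Suc n) \<omega>)) \<partial>M)
        \<le> 8 + 2 * ennreal B + ennreal (3/4) * ennreal c"
      using Suc by (intro order_trans[OF pool_obs_drift] add_mono mult_left_mono order_refl) auto
    also have "\<dots> = ennreal (8 + 2 * B + 3/4 * c)"
      using B by (simp add: c_def ennreal_mult[symmetric] flip: ennreal_plus ennreal_numeral)
    also have "8 + 2 * B + 3/4 * c = c"
      by (simp add: c_def)
    finally show ?case .
  qed
  moreover have "c \<ge> 0" using B by (simp add: c_def)
  ultimately show ?thesis by blast
qed

end

text \<open>The base \<open>sqrt 2\<close> leaves room to split a product: \<open>sqrt 2 ^ (x + y) \<le> 2 ^ x + 2 ^ y\<close>.\<close>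
lemma powr_le_sqrt2_power:
  fixes r :: real
  assumes "r > 0"
  shows "\<exists>C>0. \<forall>n::nat. real n powr r \<le> C * sqrt 2 ^ n"
proof -
  have "(\<lambda>n::nat. real n powr r / sqrt 2 ^ n) \<longlonglongrightarrow> 0"
    using assms by real_asymp
  then have "Bseq (\<lambda>n::nat. real n powr r / sqrt 2 ^ n)"
    by (intro convergent_imp_Bseq convergentI)
  then obtain C where "C > 0" "\<And>n::nat. norm (real n powr r / sqrt 2 ^ n) \<le> C"
    by (auto simp: Bseq_def)
  then show ?thesis
    by (intro exI[of _ C]) (auto simp: divide_le_eq)
qed

context block_model
begin

text \<open>The common upper bound of all pool sizes is assumed of an arbitrary \<open>Y\<close>, so that the constant
  depends neither on the node nor on the choice between observer and local pools.\<close>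
lemma moment_bound:
  fixes r :: real
  assumes r: "r > 0"
  shows "\<exists>c. \<forall>n. \<forall>Y. (AE \<omega> in M. Y \<omega> \<le> card (pool_obs P n \<omega>) + k * (card (recent P Delta n \<omega>) + 1))
    \<longrightarrow> (\<integral>\<^sup>+\<omega>. ennreal (real (Y \<omega>) powr r) \<partial>M) \<le> ennreal c"
proof -
  obtain C where C: "C > 0" "\<And>n::nat. real n powr r \<le> C * sqrt 2 ^ n"
    using powr_le_sqrt2_power[OF r] by auto
  obtain a where a: "a \<ge> 0" "\<And>n. (\<integral>\<^sup>+\<omega>. ennreal (2 ^ card (pool_obs P n \<omega>)) \<partial>M) \<le> ennreal a"
    using exp_moment_pool_obs by blast
  obtain b' where b': "\<And>n. n \<ge> 1 \<Longrightarrow> (\<integral>\<^sup>+\<omega>. ennreal ((2 ^ k) ^ card (recent P Delta n \<omega>)) \<partial>M) \<le> ennreal b'"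
    using exp_moment_recent[of "2 ^ k"] by auto
  define b where "b = max b' 1"
  have b: "(\<integral>\<^sup>+\<omega>. ennreal ((2 ^ k) ^ card (recent P Delta n \<omega>)) \<partial>M) \<le> ennreal b" for n
  proof (cases "n = 0")
    case True
    then show ?thesis by (simp add: recent_def emeasure_space_1 b_def)
  next
    case False
    then show ?thesis by (intro order_trans[OF b' ennreal_leI]) (auto simp: b_def)
  qed
  have sq: "(sqrt 2 ^ m)\<^sup>2 = (2::real) ^ m" for m
    by (simp add: power2_eq_square power_mult_distrib[symmetric])
  show ?thesis
  proof (intro exI allI impI)
    fix n and Y :: "'w \<Rightarrow> nat"
    let ?X = "\<lambda>\<omega>. card (pool_obs P n \<omega>)" and ?R = "\<lambda>\<omega>. card (recent P Delta n \<omega>)"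
    assume Y: "AE \<omega> in M. Y \<omega> \<le> ?X \<omega> + k * (?R \<omega> + 1)"
    have [measurable]: "?X \<in> measurable M (count_space UNIV)"
      by (rule measurable_from_subalg[OF subalgebra_hist measurable_card_pool_obs_hist[of n n n _ _ n]]) auto
    have [measurable]: "?R \<in> measurable M (count_space UNIV)"
      by (intro measurable_card_recent measurable_time)
    have "(\<integral>\<^sup>+\<omega>. ennreal (real (Y \<omega>) powr r) \<partial>M)
        \<le> (\<integral>\<^sup>+\<omega>. ennreal C * (ennreal (2 ^ ?X \<omega>) + ennreal (2 ^ k) * ennreal ((2 ^ k) ^ ?R \<omega>)) \<partial>M)"
    proof (rule nn_integral_mono_AE)
      show "AE \<omega> in M. ennreal (real (Y \<omega>) powr r)
          \<le> ennreal C * (ennreal (2 ^ ?X \<omega>) + ennreal (2 ^ k) * ennreal ((2 ^ k) ^ ?R \<omega>))"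
        using Y
      proof eventually_elim
        case (elim \<omega>)
        let ?u = "sqrt 2 ^ ?X \<omega>" and ?v = "sqrt 2 ^ (k * (?R \<omega> + 1))"
        have "real (Y \<omega>) powr r \<le> C * sqrt 2 ^ Y \<omega>" by (rule C)
        also have "\<dots> \<le> C * sqrt 2 ^ (?X \<omega> + k * (?R \<omega> + 1))"
          using C elim by (intro mult_left_mono power_increasing) auto
        also have "\<dots> = C * (?u * ?v)" by (simp only: power_add)
        also have "\<dots> \<le> C * (?u\<^sup>2 + ?v\<^sup>2)"
        proof (intro mult_left_mono)
          have "0 \<le> (?u - ?v)\<^sup>2" "0 \<le> ?u * ?v" by auto
          then show "?u * ?v \<le> ?u\<^sup>2 + ?v\<^sup>2" by (simp only: power2_diff)
        qed (use C in auto)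
        also have "?u\<^sup>2 = 2 ^ ?X \<omega>" by (rule sq)
        also have "?v\<^sup>2 = 2 ^ k * (2 ^ k) ^ ?R \<omega>"
          unfolding sq by (simp add: power_add power_mult)
        finally have "ennreal (real (Y \<omega>) powr r) \<le> ennreal (C * (2 ^ ?X \<omega> + 2 ^ k * (2 ^ k) ^ ?R \<omega>))"
          by (rule ennreal_leI)
        then show ?case using C by (simp add: ennreal_mult)
      qed
    qed
    also have "\<dots> = ennreal C * ((\<integral>\<^sup>+\<omega>. ennreal (2 ^ ?X \<omega>) \<partial>M)
        + ennreal (2 ^ k) * (\<integral>\<^sup>+\<omega>. ennreal ((2 ^ k) ^ ?R \<omega>) \<partial>M))"
      by (simp add: nn_integral_cmult nn_integral_add)
    also have "\<dots> \<le> ennreal C * (ennreal a + ennreal (2 ^ k) * ennreal b)"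
      using a b by (intro mult_left_mono add_mono) auto
    also have "\<dots> = ennreal (C * (a + 2 ^ k * b))"
      using C a by (simp add: ennreal_mult b_def)
    finally show "(\<integral>\<^sup>+\<omega>. ennreal (real (Y \<omega>) powr r) \<partial>M) \<le> ennreal (C * (a + 2 ^ k * b))" .
  qed
qed

end

theorem corollary3p7:
  fixes M :: "'w measure"
    and P :: "('w, 'v::finite) block_process"
    and nu :: "'v pmf"
    and D :: "'v \<Rightarrow> ('v \<Rightarrow> real) measure"
    and k :: nat
    and rate Delta :: real
  assumes "block_model M P nu D k rate Delta"
  shows "(\<forall>r::real. r > 0 \<longrightarrow> (\<exists>c::real.
            (SUP n. \<integral>\<^sup>+ \<omega>. ennreal (real (card (pool_obs P n \<omega>)) powr r) \<partial>M) \<le> ennreal c))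
       \<and> (\<forall>r::real. r > 0 \<longrightarrow> (\<exists>c::real. \<forall>i.
            (SUP n. \<integral>\<^sup>+ \<omega>. ennreal (real (card (pool P n i \<omega>)) powr r) \<partial>M) \<le> ennreal c))"
proof (intro conjI allI impI)
  interpret block_model M P nu D k rate Delta by fact
  fix r :: real assume "r > 0"
  from moment_bound[OF this] obtain c where c: "\<And>n Y.
      (AE \<omega> in M. Y \<omega> \<le> card (pool_obs P n \<omega>) + k * (card (recent P Delta n \<omega>) + 1))
      \<Longrightarrow> (\<integral>\<^sup>+\<omega>. ennreal (real (Y \<omega>) powr r) \<partial>M) \<le> ennreal c"
    by blast
  show "\<exists>c::real. (SUP n. \<integral>\<^sup>+ \<omega>. ennreal (real (card (pool_obs P n \<omega>)) powr r) \<partial>M) \<le> ennreal c"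
  proof (intro exI[of _ c] SUP_least)
    fix n
    have "AE \<omega> in M. card (pool_obs P n \<omega>) \<le> card (pool_obs P n \<omega>) + k * (card (recent P Delta n \<omega>) + 1)"
      by simp
    then show "(\<integral>\<^sup>+ \<omega>. ennreal (real (card (pool_obs P n \<omega>)) powr r) \<partial>M) \<le> ennreal c"
      by (rule c)
  qed
  show "\<exists>c::real. \<forall>i. (SUP n. \<integral>\<^sup>+ \<omega>. ennreal (real (card (pool P n i \<omega>)) powr r) \<partial>M) \<le> ennreal c"
  proof (intro exI[of _ c] allI SUP_least)
    fix n i
    have "AE \<omega> in M. card (pool P n i \<omega>) \<le> card (pool_obs P n \<omega>) + k * (card (recent P Delta n \<omega>) + 1)"
      using AE_reliable by eventually_elim (rule card_pool_le)
    then show "(\<integral>\<^sup>+ \<omega>. ennreal (real (card (pool P n i \<omega>)) powr r) \<partial>M) \<le> ennreal c"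
      by (rule c)
  qed
qed

end
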